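(* For every integer $d\ge 2$, $$\mathrm{rk}^\circ_2(3,2d)=\min\left\{s\ge 1 \;\middle|\; s\binom{d+2}{2}-\binom{s}{2}\ge\binom{2d+2}{2}\right\}.$$ Explicitly, for every integer $d\ge 1$, $$\mathrm{rk}^\circ_2(3,2d)=\left\lceil\frac{\binom{2d+2}{2}}{\binom{d+2}{2}}\right\rceil,$$ except for $d=1,3,4$, where $\mathrm{rk}^\circ_2(3,2d)=\left\lceil\binom{2d+2}{2}\big/\binom{d+2}{2}\right\rceil+1$.
   Context: All forms have complex coefficients. The $2$-rank of a ternary form $f$ of degree $2d$ (a homogeneous polynomial of degree $2d$ in $3$ variables over $\mathbb{C}$) is the smallest $s$ such that $f=g_1^2+\dots+g_s^2$ with $g_i$ ternary forms of degree $d$. The generic $2$-rank $\mathrm{rk}^\circ_2(3,2d)$ is the $2$-rank of a general ternary form of degree $2d$; equivalently, the smallest $s$ such that the set of sums $g_1^2+\dots+g_s^2$ with $g_i$ ternary forms of degree $d$ is Zariski dense in the space of ternary forms of degree $2d$. *)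

theory Defs
  imports Complex_Main "HOL-Library.Poly_Mapping" "HOL-Library.Numeral_Type"
begin

text \<open>The polynomial ring in three variables over the complex numbers, as the monoid algebra of
  the exponent vectors. The three variables are indexed by the three-element type \<^typ>\<open>3\<close>;
  the product of \<^typ>\<open>('a \<Rightarrow>\<^sub>0 nat) \<Rightarrow>\<^sub>0 complex\<close> is convolution, i.e. multiplication of polynomials.\<close>

type_synonym ternary_poly = "(3 \<Rightarrow>\<^sub>0 nat) \<Rightarrow>\<^sub>0 complex"

definition monomial_degree :: "(3 \<Rightarrow>\<^sub>0 nat) \<Rightarrow> nat" where
  "monomial_degree m = (\<Sum>i\<in>UNIV. Poly_Mapping.lookup m i)"

text \<open>As usual, the zero polynomial counts as a form of every degree, so that the forms of a given
  degree are a vector space.\<close>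

definition ternary_forms :: "nat \<Rightarrow> ternary_poly set" where
  "ternary_forms n = {f. \<forall>m\<in>Poly_Mapping.keys f. monomial_degree m = n}"

definition sums_of_squares :: "nat \<Rightarrow> nat \<Rightarrow> ternary_poly set" where
  "sums_of_squares d s = {\<Sum>i<s. g i ^ 2 | g. \<forall>i<s. g i \<in> ternary_forms d}"

text \<open>Polynomial functions on spaces of forms, i.e. polynomial expressions in the coefficients
  of a form.\<close>

inductive_set polynomial_functions :: "(ternary_poly \<Rightarrow> complex) set" where
  const: "(\<lambda>f. c) \<in> polynomial_functions"
| coeff: "(\<lambda>f. Poly_Mapping.lookup f m) \<in> polynomial_functions"
| add: "\<lbrakk>P \<in> polynomial_functions; Q \<in> polynomial_functions\<rbrakk>
    \<Longrightarrow> (\<lambda>f. P f + Q f) \<in> polynomial_functions"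
| mult: "\<lbrakk>P \<in> polynomial_functions; Q \<in> polynomial_functions\<rbrakk>
    \<Longrightarrow> (\<lambda>f. P f * Q f) \<in> polynomial_functions"

definition zariski_closed :: "nat \<Rightarrow> ternary_poly set \<Rightarrow> bool" where
  "zariski_closed n Z \<longleftrightarrow>
    (\<exists>E \<subseteq> polynomial_functions. Z = {f \<in> ternary_forms n. \<forall>P\<in>E. P f = 0})"

definition zariski_dense :: "nat \<Rightarrow> ternary_poly set \<Rightarrow> bool" where
  "zariski_dense n S \<longleftrightarrow> S \<subseteq> ternary_forms n \<and>
    (\<forall>Z. zariski_closed n Z \<and> S \<subseteq> Z \<longrightarrow> Z = ternary_forms n)"

text \<open>The generic 2-rank of ternary forms of degree \<open>2 * d\<close>; the argument is \<open>d\<close>. The minimum is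
  over a nonempty set: every form of degree \<open>2 * d\<close> is a sum of products \<open>p * q\<close> of forms of
  degree \<open>d\<close>, and \<open>p * q = ((p + q) / 2)\<^sup>2 + (\<i> * (p - q) / 2)\<^sup>2\<close>.\<close>

definition generic_two_rank :: "nat \<Rightarrow> nat" where
  "generic_two_rank d = (LEAST s. zariski_dense (2 * d) (sums_of_squares d s))"

end

theory Submission
  imports Defs "HOL-Computational_Algebra.Polynomial" "HOL-Library.FuncSet"
begin

text \<open>Write \<open>N = (d + 2 choose 2)\<close> and \<open>M = (2 * d + 2 choose 2)\<close> for the dimensions of the spaces of
  ternary forms of degree \<open>d\<close> and \<open>2 * d\<close>. Since \<open>M / N = 4 - 6 / (d + 2)\<close>, the claim amounts to:
  the generic rank is 3 for \<open>d \<le> 2\<close> and 4 for \<open>d \<ge> 3\<close>. Sums of \<open>r \<le> s\<close> squares are sums of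
  \<open>s\<close> squares, so one dense and one non-dense set of sums determine the rank.

  \<^emph>\<open>Density.\<close> If the derivative \<open>h \<mapsto> 2 * (\<Sum>i<s. g i * h i)\<close> of the map
  \<open>g \<mapsto> (\<Sum>i<s. g i ^ 2)\<close> is onto at one point \<open>g\<close>, then a polynomial that vanishes on the image
  vanishes to infinite order at the value of that point, hence is zero (\<open>sums_of_squares_dense\<close>).
  So it suffices to find \<open>s\<close> forms of degree \<open>d\<close> whose multiples by forms of degree \<open>d\<close> span all forms
  of degree \<open>2 * d\<close>. For \<open>d \<le> 2\<close> the powers \<open>X ^ d, Y ^ d, Z ^ d\<close> do, because \<open>2 * d > 3 * (d - 1)\<close>.
  For four forms, take products of lines adapted to the \<open>d\<close> by \<open>d\<close> grid of points \<open>(i : j : 1)\<close> with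
  \<open>i, j < d\<close>: the \<open>d\<close> columns, the \<open>d\<close> rows, the \<open>d\<close> antidiagonals
  \<open>i + j = k\<close> with \<open>k < d\<close>, and the remaining \<open>d - 1\<close> antidiagonals, times \<open>Z\<close>. The last two forms have no common zero on the grid and
  each leaves a triangle of grid points, on which interpolation by forms of degree \<open>d\<close> is explicit
  (\<open>lagrange_element\<close>). Their multiples thus take all values on the grid, and a form of degree \<open>2 * d\<close>
  that vanishes on the grid lies in the ideal of the columns and the rows (\<open>vanishing_on_grid\<close>).

  \<^emph>\<open>Non-density.\<close> Sums of squares are invariant under the complex orthogonal group in \<open>s\<close> variables. A sequence
  of reflections brings the matrix of coefficients of almost every tuple \<open>g\<close> into upper triangular
  shape (\<open>echelon_reflection\<close>), with only \<open>s * N - (s choose 2)\<close> free entries. If this is less than \<open>M\<close>,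
  the \<open>M\<close> coefficients of the sum of squares are polynomials in fewer than \<open>M\<close> variables, so they satisfy a
  polynomial relation (\<open>algebraic_dependence\<close>). The relation extends from triangular tuples to all tuples,
  because a polynomial in one variable that vanishes at all but finitely many points is zero
  (\<open>vanishing_echelon_step\<close>).\<close>

section \<open>Evaluating polynomials in several variables\<close>

definition monom_value :: "('v \<Rightarrow> complex) \<Rightarrow> ('v \<Rightarrow>\<^sub>0 nat) \<Rightarrow> complex" where
  "monom_value x m = (\<Prod>v\<in>Poly_Mapping.keys m. x v ^ Poly_Mapping.lookup m v)"

definition poly_value :: "('v \<Rightarrow> complex) \<Rightarrow> (('v \<Rightarrow>\<^sub>0 nat) \<Rightarrow>\<^sub>0 complex) \<Rightarrow> complex" where
  "poly_value x f = (\<Sum>m\<in>Poly_Mapping.keys f. Poly_Mapping.lookup f m * monom_value x m)"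

lemma monom_value_superset:
  assumes "finite V" "Poly_Mapping.keys m \<subseteq> V"
  shows "monom_value x m = (\<Prod>v\<in>V. x v ^ Poly_Mapping.lookup m v)"
  unfolding monom_value_def using assms
  by (intro prod.mono_neutral_left) (auto simp: in_keys_iff)

lemma monom_value_add: "monom_value x (m + n) = monom_value x m * monom_value x n"
proof -
  let ?V = "Poly_Mapping.keys m \<union> Poly_Mapping.keys n"
  have "Poly_Mapping.keys (m + n) \<subseteq> ?V" by (rule keys_add)
  then show ?thesis
    by (simp add: monom_value_superset[of ?V] lookup_add power_add prod.distrib)
qed

lemma monom_value_0 [simp]: "monom_value x 0 = 1"
  by (simp add: monom_value_def)

lemma monom_value_single [simp]: "monom_value x (Poly_Mapping.single v k) = x v ^ k"
  by (simp add: monom_value_superset[of "{v}"])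

definition var :: "'v \<Rightarrow> ('v \<Rightarrow>\<^sub>0 nat) \<Rightarrow>\<^sub>0 complex" where
  "var v = Poly_Mapping.single (Poly_Mapping.single v 1) 1"

lemma poly_value_superset:
  assumes "finite T" "Poly_Mapping.keys f \<subseteq> T"
  shows "poly_value x f = (\<Sum>m\<in>T. Poly_Mapping.lookup f m * monom_value x m)"
  unfolding poly_value_def using assms
  by (intro sum.mono_neutral_left) (auto simp: in_keys_iff)

lemma poly_value_add: "poly_value x (f + g) = poly_value x f + poly_value x g"
proof -
  let ?T = "Poly_Mapping.keys f \<union> Poly_Mapping.keys g"
  have "Poly_Mapping.keys (f + g) \<subseteq> ?T" by (rule keys_add)
  then show ?thesis
    by (simp add: poly_value_superset[of ?T] lookup_add distrib_right sum.distrib)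
qed

lemma poly_value_0 [simp]: "poly_value x 0 = 0"
  by (simp add: poly_value_def)

lemma poly_value_single [simp]: "poly_value x (Poly_Mapping.single m c) = c * monom_value x m"
  by (simp add: poly_value_superset[of "{m}"])

lemma poly_value_var [simp]: "poly_value x (var v) = x v"
  by (simp add: var_def)

lemma poly_value_1 [simp]: "poly_value x 1 = 1"
  using poly_value_single[of x 0 1] by simp

lemma poly_value_sum: "poly_value x (\<Sum>i\<in>I. f i) = (\<Sum>i\<in>I. poly_value x (f i))"
  by (induction I rule: infinite_finite_induct) (simp_all add: poly_value_add)

lemma poly_value_uminus: "poly_value x (- f) = - poly_value x f"
  using poly_value_add[of x f "- f"] by (simp add: add_eq_0_iff)

lemma poly_value_diff: "poly_value x (f - g) = poly_value x f - poly_value x g"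
  using poly_value_add[of x f "- g"] by (simp add: poly_value_uminus)

lemma poly_expansion:
  assumes "finite T" "Poly_Mapping.keys f \<subseteq> T"
  shows "f = (\<Sum>m\<in>T. Poly_Mapping.single m (Poly_Mapping.lookup f m))"
proof (rule poly_mapping_eqI)
  fix k
  have "(\<Sum>m\<in>T. Poly_Mapping.lookup (Poly_Mapping.single m (Poly_Mapping.lookup f m)) k)
      = (\<Sum>m\<in>T. if k = m then Poly_Mapping.lookup f k else 0)"
    by (intro sum.cong) (auto simp: lookup_single)
  also have "\<dots> = Poly_Mapping.lookup f k"
    using assms by (auto simp: sum.delta not_in_keys_iff_lookup_eq_zero in_keys_iff)
  finally show "Poly_Mapping.lookup f k
      = Poly_Mapping.lookup (\<Sum>m\<in>T. Poly_Mapping.single m (Poly_Mapping.lookup f m)) k"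
    by (simp add: lookup_sum)
qed

lemma poly_value_mult: "poly_value x (f * g) = poly_value x f * poly_value x g"
proof -
  let ?F = "\<lambda>m. Poly_Mapping.single m (Poly_Mapping.lookup f m)"
  let ?G = "\<lambda>m. Poly_Mapping.single m (Poly_Mapping.lookup g m)"
  have "f * g = (\<Sum>m\<in>Poly_Mapping.keys f. ?F m) * (\<Sum>n\<in>Poly_Mapping.keys g. ?G n)"
    using poly_expansion[of "Poly_Mapping.keys f" f] poly_expansion[of "Poly_Mapping.keys g" g]
    by simp
  also have "poly_value x \<dots> = poly_value x f * poly_value x g"
    unfolding sum_product poly_value_sum mult_single poly_value_single monom_value_add
    by (simp add: poly_value_def sum_product mult_ac)
  finally show ?thesis .
qed

lemma poly_value_power: "poly_value x (f ^ n) = poly_value x f ^ n"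
  by (induction n) (simp_all add: poly_value_mult)

lemma poly_value_prod: "poly_value x (\<Prod>i\<in>I. f i) = (\<Prod>i\<in>I. poly_value x (f i))"
  by (induction I rule: infinite_finite_induct) (simp_all add: poly_value_mult)

lemma poly_value_of_nat [simp]: "poly_value x (of_nat n) = of_nat n"
  by (induction n) (simp_all add: poly_value_add)

lemmas poly_value_simps = poly_value_add poly_value_diff poly_value_mult poly_value_power
  poly_value_prod poly_value_sum

section \<open>Ternary forms\<close>

lemma UNIV_3: "(UNIV :: 3 set) = {0, 1, 2}"
proof -
  have "card {0, 1, 2 :: 3} = card (UNIV :: 3 set)" by simp
  then show ?thesis by (intro card_subset_eq[symmetric]) (simp_all del: card_insert_disjoint)
qed

lemma monomial_degree_add: "monomial_degree (m + n) = monomial_degree m + monomial_degree n"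
  by (simp add: monomial_degree_def lookup_add sum.distrib)

lemma monomial_degree_single [simp]: "monomial_degree (Poly_Mapping.single v k) = k"
  by (simp add: monomial_degree_def lookup_single when_def)

lemma lookup_form_eq_0:
  "f \<in> ternary_forms n \<Longrightarrow> monomial_degree m \<noteq> n \<Longrightarrow> Poly_Mapping.lookup f m = 0"
  by (auto simp: ternary_forms_def in_keys_iff)

lemma ternary_formsI:
  "(\<And>m. monomial_degree m \<noteq> n \<Longrightarrow> Poly_Mapping.lookup f m = 0) \<Longrightarrow> f \<in> ternary_forms n"
  by (auto simp: ternary_forms_def in_keys_iff)

lemma ternary_forms_0 [simp]: "0 \<in> ternary_forms n"
  by (simp add: ternary_forms_def)

lemma ternary_forms_add:
  "f \<in> ternary_forms n \<Longrightarrow> g \<in> ternary_forms n \<Longrightarrow> f + g \<in> ternary_forms n"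
  by (intro ternary_formsI) (simp add: lookup_add lookup_form_eq_0)

lemma ternary_forms_diff:
  "f \<in> ternary_forms n \<Longrightarrow> g \<in> ternary_forms n \<Longrightarrow> f - g \<in> ternary_forms n"
  by (intro ternary_formsI) (simp add: lookup_minus lookup_form_eq_0)

lemma ternary_forms_sum:
  "(\<And>i. i \<in> I \<Longrightarrow> f i \<in> ternary_forms n) \<Longrightarrow> (\<Sum>i\<in>I. f i) \<in> ternary_forms n"
  by (induction I rule: infinite_finite_induct) (auto intro: ternary_forms_add)

lemma ternary_forms_single:
  "monomial_degree m = n \<Longrightarrow> Poly_Mapping.single m c \<in> ternary_forms n"
  by (auto simp: ternary_forms_def)

lemma ternary_forms_mult:
  assumes "f \<in> ternary_forms a" "g \<in> ternary_forms b"
  shows "f * g \<in> ternary_forms (a + b)"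
  using assms keys_mult[of f g] by (fastforce simp: ternary_forms_def monomial_degree_add)

abbreviation scalar :: "complex \<Rightarrow> ternary_poly" where
  "scalar c \<equiv> Poly_Mapping.single 0 c"

lemma lookup_scalar_mult [simp]:
  "Poly_Mapping.lookup (Poly_Mapping.single 0 c * f) m = c * Poly_Mapping.lookup f (m :: 'a::cancel_comm_monoid_add)"
proof -
  have "Poly_Mapping.lookup (Poly_Mapping.map ((*) c) f) m = c * Poly_Mapping.lookup f m"
    by (simp add: Poly_Mapping.map.rep_eq when_def)
  then show ?thesis by (simp add: mult_map_scale_conv_mult)
qed

lemma ternary_forms_scalar_mult:
  "f \<in> ternary_forms n \<Longrightarrow> scalar c * f \<in> ternary_forms n"
  by (intro ternary_formsI) (simp add: lookup_form_eq_0)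

lemma ternary_forms_1: "1 \<in> ternary_forms 0"
  by (simp add: ternary_forms_def monomial_degree_def)

lemma ternary_forms_of_nat: "of_nat k \<in> ternary_forms 0"
  by (induction k) (auto intro: ternary_forms_add ternary_forms_1)

lemma ternary_forms_power: "f \<in> ternary_forms a \<Longrightarrow> f ^ k \<in> ternary_forms (k * a)"
  by (induction k) (auto intro: ternary_forms_mult ternary_forms_1)

lemma ternary_forms_prod_linear:
  "finite I \<Longrightarrow> (\<And>i. i \<in> I \<Longrightarrow> f i \<in> ternary_forms 1) \<Longrightarrow> (\<Prod>i\<in>I. f i) \<in> ternary_forms (card I)"
proof (induction I rule: finite_induct)
  case (insert i I)
  then show ?case using ternary_forms_mult[of "f i" 1 "prod f I" "card I"] by auto
qed (simp add: ternary_forms_1)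

lemma sums_of_squares_subset_forms: "sums_of_squares d s \<subseteq> ternary_forms (2 * d)"
  unfolding sums_of_squares_def
  by (auto intro!: ternary_forms_sum) (metis ternary_forms_power)

lemma sums_of_squares_mono:
  assumes "r \<le> s"
  shows "sums_of_squares d r \<subseteq> sums_of_squares d s"
proof
  fix f assume "f \<in> sums_of_squares d r"
  then obtain g where g: "f = (\<Sum>i<r. g i ^ 2)" "\<forall>i<r. g i \<in> ternary_forms d"
    by (auto simp: sums_of_squares_def)
  let ?g = "\<lambda>i. if i < r then g i else 0"
  have "(\<Sum>i<s. ?g i ^ 2) = (\<Sum>i<r. ?g i ^ 2)"
    using assms by (intro sum.mono_neutral_right) auto
  then have "f = (\<Sum>i<s. ?g i ^ 2)" using g by simp
  moreover have "\<forall>i<s. ?g i \<in> ternary_forms d" using g by simp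
  ultimately show "f \<in> sums_of_squares d s" unfolding sums_of_squares_def
    by (intro CollectI exI[of _ ?g] conjI)
qed

text \<open>A closed set that contains \<open>S\<close> is cut out by functions each of which vanishes on \<open>S\<close>, so it is enough
  to look at one function at a time.\<close>

lemma zariski_dense_iff:
  "zariski_dense n S \<longleftrightarrow> S \<subseteq> ternary_forms n \<and>
    (\<forall>P\<in>polynomial_functions. (\<forall>f\<in>S. P f = 0) \<longrightarrow> (\<forall>f\<in>ternary_forms n. P f = 0))"
    (is "_ \<longleftrightarrow> _ \<and> ?R")
proof
  assume D: "zariski_dense n S"
  have ?R
  proof (intro ballI impI)
    fix P f assume P: "P \<in> polynomial_functions" "\<forall>f\<in>S. P f = 0" and f: "f \<in> ternary_forms n"
    let ?Z = "{f \<in> ternary_forms n. \<forall>Q\<in>{P}. Q f = 0}"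
    have "zariski_closed n ?Z" unfolding zariski_closed_def using P(1) by blast
    moreover have "S \<subseteq> ?Z" using D P(2) by (auto simp: zariski_dense_def)
    ultimately have "?Z = ternary_forms n" using D unfolding zariski_dense_def by meson
    then show "P f = 0" using f by blast
  qed
  then show "S \<subseteq> ternary_forms n \<and> ?R" using D by (simp add: zariski_dense_def)
next
  assume R: "S \<subseteq> ternary_forms n \<and> ?R"
  show "zariski_dense n S" unfolding zariski_dense_def
  proof (intro conjI allI impI)
    fix Z assume Z: "zariski_closed n Z \<and> S \<subseteq> Z"
    then obtain E where E: "E \<subseteq> polynomial_functions" "Z = {f \<in> ternary_forms n. \<forall>P\<in>E. P f = 0}"
      by (auto simp: zariski_closed_def)
    have "P f = 0" if "P \<in> E" "f \<in> ternary_forms n" for P f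
    proof -
      have "\<forall>f\<in>S. P f = 0" using Z E that(1) by blast
      then show ?thesis using R E(1) that by blast
    qed
    then show "Z = ternary_forms n" using E(2) by auto
  qed (use R in blast)
qed

lemma zariski_dense_mono:
  assumes "zariski_dense n S" "S \<subseteq> T" "T \<subseteq> ternary_forms n"
  shows "zariski_dense n T"
  using assms by (auto simp: zariski_dense_iff subset_iff)

lemma generic_two_rank_eqI:
  assumes "zariski_dense (2 * d) (sums_of_squares d (Suc s))"
    and "\<not> zariski_dense (2 * d) (sums_of_squares d s)"
  shows "generic_two_rank d = Suc s"
  unfolding generic_two_rank_def
proof (rule Least_equality)
  fix r assume r: "zariski_dense (2 * d) (sums_of_squares d r)"
  show "Suc s \<le> r"
  proof (rule ccontr)
    assume "\<not> Suc s \<le> r"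
    then have "sums_of_squares d r \<subseteq> sums_of_squares d s" by (intro sums_of_squares_mono) simp
    with r assms(2) show False using zariski_dense_mono sums_of_squares_subset_forms by blast
  qed
qed (rule assms(1))

section \<open>Polynomial functions along curves\<close>

lemma polynomial_function_along_curve:
  assumes "P \<in> polynomial_functions"
    and curve: "\<And>m. \<exists>p. \<forall>t. Poly_Mapping.lookup (u t) m = poly p t"
  shows "\<exists>p. \<forall>t. P (u t) = poly p t"
  using assms(1)
proof induction
  case (const c)
  show ?case by (rule exI[of _ "[:c:]"]) simp
next
  case (coeff m)
  show ?case by (rule curve)
next
  case (add P Q)
  then show ?case by (metis poly_add)
next
  case (mult P Q)
  then show ?case by (metis poly_mult)
qed

lemma polynomial_functions_sum:
  "(\<And>i. i \<in> I \<Longrightarrow> P i \<in> polynomial_functions) \<Longrightarrow> (\<lambda>f. \<Sum>i\<in>I. P i f) \<in> polynomial_functions"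
  by (induction I rule: infinite_finite_induct)
    (auto intro: polynomial_functions.intros)

lemma polynomial_functions_power:
  "P \<in> polynomial_functions \<Longrightarrow> (\<lambda>f. P f ^ k) \<in> polynomial_functions"
  by (induction k) (auto intro: polynomial_functions.intros)

lemma polynomial_functions_prod:
  "(\<And>i. i \<in> I \<Longrightarrow> P i \<in> polynomial_functions) \<Longrightarrow> (\<lambda>f. \<Prod>i\<in>I. P i f) \<in> polynomial_functions"
  by (induction I rule: infinite_finite_induct)
    (auto intro: polynomial_functions.intros)

text \<open>The Taylor expansion at \<open>c\<close>: the function \<open>Q k\<close> is the part of degree \<open>k\<close>.\<close>

lemma polynomial_function_expansion:
  assumes "P \<in> polynomial_functions"
  shows "\<exists>n Q. (\<forall>k. Q k \<in> polynomial_functions) \<and>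
    (\<forall>w t. P (c + scalar t * w) = (\<Sum>k\<le>n. t ^ k * Q k w))"
  using assms
proof induction
  case (const b)
  have "\<forall>w t. b = (\<Sum>k\<le>(0::nat). t ^ k * b)" by simp
  then show ?case
    by (intro exI[of _ 0] exI[of _ "\<lambda>_ _. b"]) (auto intro: polynomial_functions.const)
next
  case (coeff m)
  let ?Q = "\<lambda>k w. if k = 0 then Poly_Mapping.lookup c m else Poly_Mapping.lookup w m"
  have "?Q k \<in> polynomial_functions" for k :: nat
    by (cases "k = 0") (simp_all add: polynomial_functions.const polynomial_functions.coeff)
  moreover have "\<forall>w t. Poly_Mapping.lookup (c + scalar t * w) m = (\<Sum>k\<le>Suc 0. t ^ k * ?Q k w)"
    by (simp add: lookup_add)
  ultimately show ?case by (intro exI[of _ "Suc 0"] exI[of _ ?Q]) blast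
next
  case (add P1 P2)
  then obtain n1 Q1 n2 Q2 where
    Q: "\<forall>k. Q1 k \<in> polynomial_functions" "\<forall>k. Q2 k \<in> polynomial_functions"
    and e: "\<forall>w t. P1 (c + scalar t * w) = (\<Sum>k\<le>n1. t ^ k * Q1 k w)"
      "\<forall>w t. P2 (c + scalar t * w) = (\<Sum>k\<le>n2. t ^ k * Q2 k w)" by blast
  let ?Q = "\<lambda>k w. (if k \<le> n1 then Q1 k w else 0) + (if k \<le> n2 then Q2 k w else 0)"
  have "?Q k \<in> polynomial_functions" for k
    using Q by (intro polynomial_functions.add; cases "k \<le> n1"; cases "k \<le> n2")
      (simp_all add: polynomial_functions.const)
  moreover have "P1 (c + scalar t * w) + P2 (c + scalar t * w)
      = (\<Sum>k\<le>max n1 n2. t ^ k * ?Q k w)" for w t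
  proof -
    have "(\<Sum>k\<le>n1. t ^ k * Q1 k w) = (\<Sum>k\<le>max n1 n2. t ^ k * (if k \<le> n1 then Q1 k w else 0))"
      by (intro sum.mono_neutral_cong_left) auto
    moreover have "(\<Sum>k\<le>n2. t ^ k * Q2 k w) = (\<Sum>k\<le>max n1 n2. t ^ k * (if k \<le> n2 then Q2 k w else 0))"
      by (intro sum.mono_neutral_cong_left) auto
    ultimately show ?thesis using e by (simp add: distrib_left sum.distrib)
  qed
  ultimately show ?case by (intro exI[of _ "max n1 n2"] exI[of _ ?Q]) blast
next
  case (mult P1 P2)
  then obtain n1 Q1 n2 Q2 where
    Q: "\<forall>k. Q1 k \<in> polynomial_functions" "\<forall>k. Q2 k \<in> polynomial_functions"
    and e: "\<forall>w t. P1 (c + scalar t * w) = (\<Sum>k\<le>n1. t ^ k * Q1 k w)"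
      "\<forall>w t. P2 (c + scalar t * w) = (\<Sum>k\<le>n2. t ^ k * Q2 k w)" by blast
  let ?Q = "\<lambda>k w. \<Sum>(i, j)\<in>{(i, j). i \<le> n1 \<and> j \<le> n2 \<and> i + j = k}. Q1 i w * Q2 j w"
  have "?Q k \<in> polynomial_functions" for k
    using Q by (auto intro!: polynomial_functions_sum polynomial_functions.mult split: prod.splits)
  moreover have "P1 (c + scalar t * w) * P2 (c + scalar t * w)
      = (\<Sum>k\<le>n1 + n2. t ^ k * ?Q k w)" for w t
  proof -
    have "(\<Sum>k\<le>n1 + n2. t ^ k * ?Q k w)
        = (\<Sum>k\<le>n1 + n2. \<Sum>(i, j)\<in>{p \<in> {..n1} \<times> {..n2}. fst p + snd p = k}.
            (t ^ i * Q1 i w) * (t ^ j * Q2 j w))"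
      unfolding sum_distrib_left
      by (intro sum.cong) (auto simp: power_add mult_ac)
    also have "\<dots> = (\<Sum>(i, j)\<in>{..n1} \<times> {..n2}. (t ^ i * Q1 i w) * (t ^ j * Q2 j w))"
      by (rule sum.group) auto
    also have "\<dots> = (\<Sum>i\<le>n1. t ^ i * Q1 i w) * (\<Sum>j\<le>n2. t ^ j * Q2 j w)"
      by (simp add: sum_product sum.cartesian_product)
    finally show ?thesis using e by simp
  qed
  ultimately show ?case by (intro exI[of _ "n1 + n2"] exI[of _ ?Q]) blast
qed

text \<open>A sum of squares of forms that depend linearly on \<open>t\<close> moves along such a curve.\<close>

lemma lookup_quadratic_curve:
  "\<exists>p. \<forall>t. Poly_Mapping.lookup (a + scalar t * b + scalar (t ^ 2) * q) m = poly p t"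
  by (rule exI[of _ "[:Poly_Mapping.lookup a m, Poly_Mapping.lookup b m, Poly_Mapping.lookup q m:]"])
    (simp add: lookup_add power2_eq_square distrib_left mult.assoc)

text \<open>Take a polynomial function that vanishes on the sums of squares and expand it around \<open>c\<close>, the sum of
  the squares of the \<open>g i\<close>. A form \<open>y\<close> is the tangent direction of a curve
  \<open>c + t * y + t\<^sup>2 * q\<close> of sums of squares. Along this curve the lowest Taylor term \<open>Q k\<close> dominates as
  \<open>t\<close> goes to zero, so \<open>Q k y = 0\<close>. Hence all Taylor terms vanish, one degree after the other.\<close>

lemma sums_of_squares_dense:
  assumes g: "\<And>i. i < s \<Longrightarrow> g i \<in> ternary_forms d"
    and onto: "\<And>f. f \<in> ternary_forms (2 * d) \<Longrightarrow>
      \<exists>h. (\<forall>i<s. h i \<in> ternary_forms d) \<and> f = (\<Sum>i<s. g i * h i)"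
  shows "zariski_dense (2 * d) (sums_of_squares d s)"
  unfolding zariski_dense_iff
proof (intro conjI ballI impI)
  fix P f assume P: "P \<in> polynomial_functions" "\<forall>f\<in>sums_of_squares d s. P f = 0"
    and f: "f \<in> ternary_forms (2 * d)"
  define c where "c = (\<Sum>i<s. g i ^ 2)"
  have c: "c \<in> ternary_forms (2 * d)"
    unfolding c_def using g by (intro ternary_forms_sum) (metis ternary_forms_power lessThan_iff)
  obtain n Q where Q: "\<And>k. Q k \<in> polynomial_functions"
    and expand: "\<And>w t. P (c + scalar t * w) = (\<Sum>k\<le>n. t ^ k * Q k w)"
    using polynomial_function_expansion[OF P(1)] by blast
  have "\<forall>y\<in>ternary_forms (2 * d). k \<le> n \<longrightarrow> Q k y = 0" for k
  proof (induction k rule: less_induct)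
    case (less k)
    show ?case
    proof (intro ballI impI)
      fix y assume y: "y \<in> ternary_forms (2 * d)" and k: "k \<le> n"
      obtain h where h: "\<forall>i<s. h i \<in> ternary_forms d" and yh: "scalar (1 / 2) * y = (\<Sum>i<s. g i * h i)"
        using onto[of "scalar (1 / 2) * y"] y by (auto intro: ternary_forms_scalar_mult)
      define q where "q = (\<Sum>i<s. h i ^ 2)"
      have q: "q \<in> ternary_forms (2 * d)"
        unfolding q_def using h by (intro ternary_forms_sum) (metis ternary_forms_power lessThan_iff)
      have "scalar 2 * (scalar (1 / 2) * y) = y"
        by (rule poly_mapping_eqI) (simp del: single_numeral)
      then have y2: "y = (\<Sum>i<s. 2 * (g i * h i))" by (simp add: yh sum_distrib_left)
      have w: "y + scalar t * q \<in> ternary_forms (2 * d)" for t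
        using y q by (intro ternary_forms_add ternary_forms_scalar_mult)
      have zero: "(\<Sum>i\<le>n. t ^ i * Q i (y + scalar t * q)) = 0" for t
      proof -
        have "c + scalar t * (y + scalar t * q) = (\<Sum>i<s. (g i + scalar t * h i) ^ 2)"
        proof -
          have "(\<Sum>i<s. (g i + scalar t * h i) ^ 2)
              = (\<Sum>i<s. g i ^ 2 + scalar t * (2 * (g i * h i)) + scalar t * (scalar t * h i ^ 2))"
            by (intro sum.cong) (simp_all add: power2_eq_square algebra_simps)
          then show ?thesis
            unfolding c_def y2 q_def by (simp add: sum.distrib sum_distrib_left distrib_left)
        qed
        also have "\<dots> \<in> sums_of_squares d s"
          unfolding sums_of_squares_def using g h
          by (auto intro!: exI[of _ "\<lambda>i. g i + scalar t * h i"] ternary_forms_add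
              ternary_forms_scalar_mult)
        finally show ?thesis using P(2) expand by metis
      qed
      have "\<exists>p. \<forall>t. Q i (y + scalar t * q) = poly p t" for i
        by (rule polynomial_function_along_curve[OF Q])
          (use lookup_quadratic_curve[of y q 0] in simp)
      then obtain p where p: "\<And>i t. Q i (y + scalar t * q) = poly (p i) t" by metis
      \<comment> \<open>By induction only the terms from \<open>k\<close> on remain; \<open>R\<close> is their sum along the curve, divided by
        \<open>t ^ k\<close>, and its value at zero is \<open>Q k y\<close>.\<close>
      define R where "R = (\<Sum>i\<in>{k..n}. monom 1 (i - k) * p i)"
      have "monom 1 k * R = 0"
      proof (rule poly_eq_poly_eq_iff[THEN iffD1], rule ext)
        fix t :: complex
        have "poly (monom 1 k * R) t = (\<Sum>i\<in>{k..n}. t ^ i * Q i (y + scalar t * q))"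
          unfolding R_def p
          by (auto simp: poly_monom poly_sum sum_distrib_left mult.assoc[symmetric]
              power_add[symmetric] intro!: sum.cong)
        also have "\<dots> = (\<Sum>i\<le>n. t ^ i * Q i (y + scalar t * q))"
        proof (rule sum.mono_neutral_left)
          show "\<forall>i\<in>{..n} - {k..n}. t ^ i * Q i (y + scalar t * q) = 0"
          proof
            fix i assume "i \<in> {..n} - {k..n}"
            then have "i < k" "i \<le> n" by auto
            then show "t ^ i * Q i (y + scalar t * q) = 0" using less.IH[of i] w by simp
          qed
        qed auto
        finally show "poly (monom 1 k * R) t = poly 0 t" using zero by simp
      qed
      then have "R = 0" by (simp add: monom_eq_0_iff)
      then have "poly R 0 = 0" by simp
      moreover have "poly R 0 = (\<Sum>i\<in>{k..n}. if i = k then poly (p k) 0 else 0)"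
        unfolding R_def poly_sum
        by (intro sum.cong) (auto simp: poly_monom power_0_left)
      ultimately have "poly (p k) 0 = 0" using k by simp
      then show "Q k y = 0" using p[of k 0] by simp
    qed
  qed
  moreover have "f = c + scalar 1 * (f - c)" by simp
  ultimately show "P f = 0"
    using expand[of 1 "f - c"] ternary_forms_diff[OF f c] by (simp add: sum.neutral)
qed (rule sums_of_squares_subset_forms)

section \<open>Counting monomials\<close>

definition monomials :: "nat \<Rightarrow> (3 \<Rightarrow>\<^sub>0 nat) set" where
  "monomials n = {m. monomial_degree m = n}"

definition xyz :: "nat \<Rightarrow> nat \<Rightarrow> nat \<Rightarrow> (3 \<Rightarrow>\<^sub>0 nat)" where
  "xyz a b c = Poly_Mapping.single 0 a + Poly_Mapping.single 1 b + Poly_Mapping.single 2 c"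

lemma lookup_xyz [simp]:
  "Poly_Mapping.lookup (xyz a b c) 0 = a"
  "Poly_Mapping.lookup (xyz a b c) 1 = b"
  "Poly_Mapping.lookup (xyz a b c) 2 = c"
  by (simp_all add: xyz_def lookup_add lookup_single when_def)

lemma monomial_degree_xyz [simp]: "monomial_degree (xyz a b c) = a + b + c"
  by (simp add: xyz_def monomial_degree_add)

lemma eq_xyz:
  "m = xyz (Poly_Mapping.lookup m 0) (Poly_Mapping.lookup m 1) (Poly_Mapping.lookup m 2)"
proof (rule poly_mapping_eqI)
  fix i :: 3
  have "i \<in> {0, 1, 2}" using UNIV_3 by blast
  then show "Poly_Mapping.lookup m i = Poly_Mapping.lookup
      (xyz (Poly_Mapping.lookup m 0) (Poly_Mapping.lookup m 1) (Poly_Mapping.lookup m 2)) i"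
    by (elim insertE emptyE; hypsubst; simp only: lookup_xyz)
qed

lemma finite_and_card_monomials: "finite (monomials n) \<and> card (monomials n) = (n + 2) choose 2"
proof -
  let ?T = "SIGMA a:{..n}. {..n - a}"
  let ?f = "\<lambda>(a, b). xyz a b (n - a - b)"
  have "bij_betw ?f ?T (monomials n)"
  proof (rule bij_betw_imageI)
    show "inj_on ?f ?T"
    proof (rule inj_onI, clarify)
      fix a b a' b' assume "xyz a b (n - a - b) = xyz a' b' (n - a' - b')"
      then show "a = a' \<and> b = b'" by (metis lookup_xyz(1,2))
    qed
    show "?f ` ?T = monomials n"
    proof
      show "?f ` ?T \<subseteq> monomials n" by (auto simp: monomials_def)
      show "monomials n \<subseteq> ?f ` ?T"
      proof
        fix m assume m: "m \<in> monomials n"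
        obtain a b c where abc: "m = xyz a b c" using eq_xyz by blast
        then have "a + b + c = n" using m by (simp add: monomials_def)
        then show "m \<in> ?f ` ?T" using abc by (intro image_eqI[of _ _ "(a, b)"]) auto
      qed
    qed
  qed
  moreover have "card ?T = (n + 2) choose 2"
  proof -
    have "card ?T = (\<Sum>a\<le>n. Suc (n - a))" by simp
    also have "\<dots> = (\<Sum>a\<le>n. Suc a)"
      by (rule sum.reindex_bij_witness[of _ "\<lambda>a. n - a" "\<lambda>a. n - a"]) auto
    also have "\<dots> = (n + 2) choose 2"
    proof (induction n)
      case (Suc n)
      have "(Suc n + 2) choose 2 = Suc (Suc n) + ((n + 2) choose 2)"
        using binomial_Suc_Suc[of "n + 2" 1] unfolding Suc_1 choose_one add_Suc by simp
      then show ?case using Suc by simp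
    qed (simp add: numeral_2_eq_2)
    finally show ?thesis .
  qed
  moreover have "finite ?T" by simp
  ultimately show ?thesis using bij_betw_finite[of ?f ?T] bij_betw_same_card[of ?f ?T] by auto
qed

lemmas finite_monomials [simp] = finite_and_card_monomials[THEN conjunct1]
  and card_monomials = finite_and_card_monomials[THEN conjunct2]

section \<open>Algebraic dependence\<close>

text \<open>Gaussian elimination, one equation at a time.\<close>

lemma underdetermined_system:
  fixes a :: "'k \<Rightarrow> 'e \<Rightarrow> complex"
  assumes "finite E" "finite K" "card E < card K"
  shows "\<exists>c. (\<exists>k\<in>K. c k \<noteq> 0) \<and> (\<forall>e\<in>E. (\<Sum>k\<in>K. c k * a k e) = 0)"
  using assms
proof (induction E arbitrary: K a rule: finite_induct)
  case empty
  then show ?case by (intro exI[of _ "\<lambda>_. 1"]) (auto simp: card_gt_0_iff)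
next
  case (insert e E)
  show ?case
  proof (cases "\<forall>k\<in>K. a k e = 0")
    case True
    then show ?thesis using insert.IH[of K a] insert.prems insert.hyps by auto
  next
    case False
    then obtain p where p: "p \<in> K" "a p e \<noteq> 0" by blast
    let ?K = "K - {p}"
    let ?a = "\<lambda>k e'. a k e' - a k e / a p e * a p e'"
    have "card E < card ?K" using insert.prems insert.hyps p by simp
    then obtain c where c: "\<exists>k\<in>?K. c k \<noteq> 0" "\<forall>e'\<in>E. (\<Sum>k\<in>?K. c k * ?a k e') = 0"
      using insert.IH[of ?K ?a] insert.prems by auto
    define c' where "c' = c(p := - (\<Sum>k\<in>?K. c k * (a k e / a p e)))"
    have S: "(\<Sum>k\<in>K. c' k * a k e') = (\<Sum>k\<in>?K. c k * ?a k e')" for e'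
    proof -
      have "(\<Sum>k\<in>K. c' k * a k e') = c' p * a p e' + (\<Sum>k\<in>?K. c' k * a k e')"
        using p insert.prems by (simp add: sum.remove)
      also have "(\<Sum>k\<in>?K. c' k * a k e') = (\<Sum>k\<in>?K. c k * a k e')"
        by (intro sum.cong) (auto simp: c'_def)
      finally show ?thesis
        by (simp add: c'_def right_diff_distrib sum_subtractf sum_distrib_right mult.assoc)
    qed
    have "\<exists>k\<in>K. c' k \<noteq> 0" using c(1) by (auto simp: c'_def)
    moreover have "(\<Sum>k\<in>K. c' k * a k e) = 0"
      unfolding S using p by simp
    ultimately show ?thesis using c(2) S by (intro exI[of _ c']) simp
  qed
qed

text \<open>Bounding each exponent separately, and not the total degree, makes these monomials easy to count.\<close>

definition box :: "'v set \<Rightarrow> nat \<Rightarrow> ('v \<Rightarrow>\<^sub>0 nat) set" where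
  "box V K = {m. Poly_Mapping.keys m \<subseteq> V \<and> (\<forall>v. Poly_Mapping.lookup m v \<le> K)}"

lemma finite_box_and_card_le:
  assumes "finite V"
  shows "finite (box V K) \<and> card (box V K) \<le> (K + 1) ^ card V"
proof -
  let ?r = "\<lambda>m. restrict (Poly_Mapping.lookup m) V"
  have inj: "inj_on ?r (box V K)"
  proof (rule inj_onI)
    fix m n assume mn: "m \<in> box V K" "n \<in> box V K" "?r m = ?r n"
    show "m = n"
    proof (rule poly_mapping_eqI)
      fix v
      show "Poly_Mapping.lookup m v = Poly_Mapping.lookup n v"
      proof (cases "v \<in> V")
        case True
        then show ?thesis using fun_cong[OF mn(3), of v] by simp
      next
        case False
        then have "v \<notin> Poly_Mapping.keys m" "v \<notin> Poly_Mapping.keys n"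
          using mn by (auto simp: box_def)
        then show ?thesis by (simp add: in_keys_iff)
      qed
    qed
  qed
  have sub: "?r ` box V K \<subseteq> PiE V (\<lambda>_. {..K})" by (auto simp: box_def)
  have fin: "finite (PiE V (\<lambda>_. {..K}))" using assms by (intro finite_PiE) auto
  have "card (PiE V (\<lambda>_. {..K})) = (K + 1) ^ card V" using assms by (simp add: card_PiE)
  then show ?thesis
    using card_inj_on_le[OF inj sub fin] finite_imageD[OF finite_subset[OF sub fin] inj] by simp
qed

lemma box_mono: "K \<le> L \<Longrightarrow> box V K \<subseteq> box V L"
  by (auto simp: box_def intro: order_trans)

lemma keys_mult_box:
  assumes "Poly_Mapping.keys f \<subseteq> box V K" "Poly_Mapping.keys g \<subseteq> box V L"
  shows "Poly_Mapping.keys (f * g) \<subseteq> box V (K + L)"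
proof
  fix m assume "m \<in> Poly_Mapping.keys (f * g)"
  then obtain a b where ab: "m = a + b" "a \<in> box V K" "b \<in> box V L"
    using keys_mult[of f g] assms by blast
  then show "m \<in> box V (K + L)"
    using keys_add[of a b] by (auto simp: box_def lookup_add intro: add_mono)
qed

lemma keys_one_box: "Poly_Mapping.keys (1 :: _ \<Rightarrow>\<^sub>0 complex) \<subseteq> box V 0"
  by (simp add: box_def)

lemma keys_power_box:
  "Poly_Mapping.keys (f :: _ \<Rightarrow>\<^sub>0 complex) \<subseteq> box V K \<Longrightarrow> Poly_Mapping.keys (f ^ n) \<subseteq> box V (n * K)"
  by (induction n) (use keys_one_box in \<open>auto dest: keys_mult_box\<close>)

lemma keys_prod_box:
  assumes "finite I" "\<And>i. i \<in> I \<Longrightarrow> Poly_Mapping.keys (f i :: _ \<Rightarrow>\<^sub>0 complex) \<subseteq> box V K"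
  shows "Poly_Mapping.keys (\<Prod>i\<in>I. f i) \<subseteq> box V (card I * K)"
  using assms
proof (induction I rule: finite_induct)
  case empty
  then show ?case using keys_one_box by simp
next
  case (insert i I)
  then show ?case using keys_mult_box[of "f i" V K "prod f I" "card I * K"] by simp
qed

lemma keys_sum_subset:
  fixes f :: "'i \<Rightarrow> 'a \<Rightarrow>\<^sub>0 complex"
  assumes "\<And>i. i \<in> I \<Longrightarrow> Poly_Mapping.keys (f i) \<subseteq> T"
  shows "Poly_Mapping.keys (\<Sum>i\<in>I. f i) \<subseteq> T"
  using assms
proof (induction I rule: infinite_finite_induct)
  case (insert i I)
  then show ?case using keys_add[of "f i" "sum f I"] by auto
qed auto

definition digit :: "nat \<Rightarrow> nat \<Rightarrow> nat \<Rightarrow> nat" where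
  "digit B k j = k div B ^ j mod B"

text \<open>This identity drives a Kronecker substitution: the monomial in \<open>y\<close> whose exponents are the digits of \<open>k\<close> becomes
  \<open>t ^ k\<close> when \<open>y j = t ^ (B ^ j)\<close>. Hence the numbers below \<open>B ^ M\<close> enumerate the monomials in \<open>M\<close> variables
  with all exponents below \<open>B\<close>, and distinct monomials stay distinct under the substitution.\<close>

lemma sum_digits: "(\<Sum>j<M. digit B k j * B ^ j) = k mod B ^ M"
proof (induction M)
  case (Suc M)
  have "k mod (B ^ M * B) = B ^ M * (k div B ^ M mod B) + k mod B ^ M"
    by (rule mod_mult2_eq)
  then show ?case using Suc by (simp add: digit_def mult.commute)
qed simp

text \<open>More polynomials than variables are algebraically dependent, by counting. There are \<open>B ^ M\<close> monomials in
  the \<open>\<phi> j\<close> with exponents below \<open>B\<close>. They involve at most \<open>(B * (M * K + 1)) ^ card V\<close> monomials in the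
  variables, which grows with a smaller power of \<open>B\<close>. So for large \<open>B\<close> there are more monomials in
  the \<open>\<phi> j\<close> than linear conditions for a relation between them.\<close>

lemma algebraic_dependence:
  fixes \<phi> :: "nat \<Rightarrow> ('v \<Rightarrow>\<^sub>0 nat) \<Rightarrow>\<^sub>0 complex"
  assumes V: "finite V" "card V < M"
    and \<phi>: "\<And>j. j < M \<Longrightarrow> Poly_Mapping.keys (\<phi> j) \<subseteq> box V K"
  shows "\<exists>B c. (\<exists>k<B ^ M. c k \<noteq> (0::complex)) \<and>
    (\<forall>x. (\<Sum>k<B ^ M. c k * (\<Prod>j<M. poly_value x (\<phi> j) ^ digit B k j)) = 0)"
proof -
  \<comment> \<open>The least base for which \<open>(B * (M * K + 1)) ^ card V < B ^ (card V + 1)\<close>.\<close>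
  define B where "B = (M * K + 1) ^ card V + 1"
  define N where "N = M * ((B - 1) * K)"
  define f where "f k = (\<Prod>j<M. \<phi> j ^ digit B k j)" for k
  have keys: "Poly_Mapping.keys (f k) \<subseteq> box V N" for k
  proof -
    have "Poly_Mapping.keys (\<phi> j ^ digit B k j) \<subseteq> box V ((B - 1) * K)" if "j < M" for j
    proof -
      have "digit B k j < B" by (simp add: digit_def B_def)
      then have "digit B k j * K \<le> (B - 1) * K" by (intro mult_right_mono) auto
      then show ?thesis using keys_power_box[OF \<phi>[OF that]] box_mono by blast
    qed
    then show ?thesis
      unfolding f_def N_def using keys_prod_box[of "{..<M}" "\<lambda>j. \<phi> j ^ digit B k j" V "(B - 1) * K"]
      by (simp del: One_nat_def)
  qed
  have "card (box V N) \<le> (N + 1) ^ card V" using finite_box_and_card_le V(1) by blast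
  also have "\<dots> \<le> (B * (M * K + 1)) ^ card V"
  proof (intro power_mono)
    have "M * ((B - 1) * K) \<le> B * (M * K)" by (simp add: mult.left_commute)
    then show "N + 1 \<le> B * (M * K + 1)" by (simp add: N_def B_def)
  qed simp
  also have "\<dots> = B ^ card V * (B - 1)" unfolding power_mult_distrib by (simp add: B_def)
  also have "\<dots> < B ^ card V * B" by (simp add: B_def)
  also have "\<dots> = B ^ Suc (card V)" by simp
  also have "\<dots> \<le> B ^ M" using V(2) by (intro power_increasing) (auto simp: B_def)
  finally have "card (box V N) < card {..<B ^ M}" by simp
  then obtain c where c: "\<exists>k\<in>{..<B ^ M}. c k \<noteq> 0"
    "\<forall>m\<in>box V N. (\<Sum>k<B ^ M. c k * Poly_Mapping.lookup (f k) m) = 0"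
    using underdetermined_system[of "box V N" "{..<B ^ M}" "\<lambda>k m. Poly_Mapping.lookup (f k) m"]
      finite_box_and_card_le[OF V(1)] by blast
  show ?thesis
  proof (rule exI[of _ B], rule exI[of _ c], intro conjI allI)
    fix x
    have "(\<Sum>k<B ^ M. c k * (\<Prod>j<M. poly_value x (\<phi> j) ^ digit B k j))
        = (\<Sum>k<B ^ M. c k * poly_value x (f k))"
      by (simp add: f_def poly_value_prod poly_value_power)
    also have "\<dots> = (\<Sum>k<B ^ M. \<Sum>m\<in>box V N. c k * Poly_Mapping.lookup (f k) m * monom_value x m)"
      using poly_value_superset[OF _ keys] finite_box_and_card_le[OF V(1)]
      by (simp add: sum_distrib_left mult.assoc)
    also have "\<dots> = (\<Sum>m\<in>box V N. (\<Sum>k<B ^ M. c k * Poly_Mapping.lookup (f k) m) * monom_value x m)"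
      by (subst sum.swap) (simp add: sum_distrib_right)
    also have "\<dots> = 0" using c(2) by simp
    finally show "(\<Sum>k<B ^ M. c k * (\<Prod>j<M. poly_value x (\<phi> j) ^ digit B k j)) = 0" .
  qed (use c(1) in blast)
qed

text \<open>A relation that vanishes on the parametrized family, read as a function of the coefficients of a form. It is not zero on
  all forms of degree \<open>n\<close>, since the Kronecker substitution turns it into a nonzero polynomial in one variable.\<close>

lemma polynomial_function_relation:
  fixes \<phi> :: "nat \<Rightarrow> ('v \<Rightarrow>\<^sub>0 nat) \<Rightarrow>\<^sub>0 complex"
  assumes V: "finite V" "card V < M"
    and \<phi>: "\<And>j. j < M \<Longrightarrow> Poly_Mapping.keys (\<phi> j) \<subseteq> box V K"
    and \<mu>: "bij_betw \<mu> {..<M} (monomials n)"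
  shows "\<exists>P\<in>polynomial_functions. (\<exists>f\<in>ternary_forms n. P f \<noteq> 0) \<and>
    (\<forall>f x. (\<forall>j<M. Poly_Mapping.lookup f (\<mu> j) = poly_value x (\<phi> j)) \<longrightarrow> P f = 0)"
proof -
  obtain B c where c: "\<exists>k<B ^ M. c k \<noteq> (0::complex)"
    and rel: "\<forall>x. (\<Sum>k<B ^ M. c k * (\<Prod>j<M. poly_value x (\<phi> j) ^ digit B k j)) = 0"
    using algebraic_dependence[where \<phi> = \<phi> and K = K, OF V \<phi>] by blast
  define P where "P f = (\<Sum>k<B ^ M. c k * (\<Prod>j<M. Poly_Mapping.lookup f (\<mu> j) ^ digit B k j))" for f
  show ?thesis
  proof (intro bexI[of _ P] conjI allI impI)
    show "P \<in> polynomial_functions"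
      unfolding P_def
      by (intro polynomial_functions_sum polynomial_functions.mult polynomial_functions_prod
          polynomial_functions_power polynomial_functions.const polynomial_functions.coeff)
  next
    define u where "u t = (\<Sum>j<M. Poly_Mapping.single (\<mu> j) (t ^ (B ^ j)))" for t :: complex
    have u: "Poly_Mapping.lookup (u t) (\<mu> j) = t ^ (B ^ j)" if "j < M" for t j
    proof -
      have "Poly_Mapping.lookup (u t) (\<mu> j) = (\<Sum>i<M. if i = j then t ^ (B ^ j) else 0)"
        unfolding u_def lookup_sum using \<mu> that
        by (intro sum.cong) (auto simp: lookup_single when_def bij_betw_def dest: inj_onD)
      then show ?thesis using that by simp
    qed
    have form: "u t \<in> ternary_forms n" for t
      unfolding u_def using bij_betwE[OF \<mu>]
      by (intro ternary_forms_sum ternary_forms_single) (auto simp: monomials_def)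
    have Pu: "P (u t) = (\<Sum>k<B ^ M. c k * t ^ k)" for t
      unfolding P_def
    proof (intro sum.cong refl arg_cong2[where f = "(*)"])
      fix k assume "k \<in> {..<B ^ M}"
      then have "k < B ^ M" by simp
      have "(\<Prod>j<M. Poly_Mapping.lookup (u t) (\<mu> j) ^ digit B k j) = (\<Prod>j<M. t ^ (digit B k j * B ^ j))"
        by (intro prod.cong) (simp_all add: u power_mult[symmetric] mult.commute)
      also have "\<dots> = t ^ (\<Sum>j<M. digit B k j * B ^ j)" by (simp add: power_sum)
      finally show "(\<Prod>j<M. Poly_Mapping.lookup (u t) (\<mu> j) ^ digit B k j) = t ^ k"
        using \<open>k < B ^ M\<close> by (simp add: sum_digits)
    qed
    define p where "p = (\<Sum>k<B ^ M. monom (c k) k)"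
    have pt: "poly p t = P (u t)" for t by (simp add: p_def Pu poly_sum poly_monom)
    obtain k where k: "k < B ^ M" "c k \<noteq> 0" using c by blast
    have "coeff p k = (\<Sum>i<B ^ M. if i = k then c i else 0)"
      by (simp add: p_def coeff_sum)
    then have "coeff p k = c k" using k by simp
    then have "p \<noteq> 0" using k by auto
    then obtain t where "poly p t \<noteq> 0" using poly_all_0_iff_0 by blast
    then show "\<exists>f\<in>ternary_forms n. P f \<noteq> 0" using pt form by metis
  next
    fix f x assume "\<forall>j<M. Poly_Mapping.lookup f (\<mu> j) = poly_value x (\<phi> j)"
    then show "P f = 0" unfolding P_def using rel by simp
  qed
qed

section \<open>Sums of few squares are not dense\<close>

text \<open>The columns \<open>0, \<dots>, k - 1\<close> of the coefficient matrix (row \<open>i\<close> belongs to \<open>g i\<close>, column \<open>j\<close> to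
  the monomial \<open>\<nu> j\<close>) are zero below the diagonal.\<close>

definition echelon :: "nat \<Rightarrow> nat \<Rightarrow> (nat \<Rightarrow> 3 \<Rightarrow>\<^sub>0 nat) \<Rightarrow> nat \<Rightarrow> (nat \<Rightarrow> ternary_poly) set" where
  "echelon d s \<nu> k = {g. (\<forall>i<s. g i \<in> ternary_forms d) \<and>
     (\<forall>j<k. \<forall>i. j < i \<and> i < s \<longrightarrow> Poly_Mapping.lookup (g i) (\<nu> j) = 0)}"

text \<open>A Householder step of the QR decomposition, for the bilinear form \<open>\<Sum>i. x i * y i\<close> on complex vectors. The
  reflection in \<open>w = v - a * e\<close>, with \<open>e\<close> the unit vector of index \<open>k\<close> and \<open>a\<^sup>2\<close> the norm of
  \<open>v\<close>, maps the tail \<open>v\<close> of column \<open>k\<close> to \<open>a * e\<close>. It acts only on the rows from \<open>k\<close> on, so it keeps the zeros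
  of the earlier columns. The hypothesis excludes isotropic tails: an orthogonal map
  cannot take a nonzero one to a multiple of \<open>e\<close>.\<close>

lemma echelon_reflection:
  assumes g: "g \<in> echelon d s \<nu> k" and k: "k < s"
    and nz: "(\<Sum>i\<in>{k..<s}. Poly_Mapping.lookup (g i) (\<nu> k) ^ 2) \<noteq> 0"
  shows "\<exists>g'\<in>echelon d s \<nu> (Suc k). (\<Sum>i<s. g' i ^ 2) = (\<Sum>i<s. g i ^ 2)"
proof -
  let ?I = "{k..<s}"
  define v where "v i = Poly_Mapping.lookup (g i) (\<nu> k)" for i
  define Q where "Q = (\<Sum>i\<in>?I. v i ^ 2)"
  have Q: "Q \<noteq> 0" using nz by (simp add: Q_def v_def)
  \<comment> \<open>The sign of the square root is chosen such that \<open>w\<close> is not isotropic: its norm is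
    \<open>2 * a * (a - v k)\<close>.\<close>
  obtain a where a: "a ^ 2 = Q" "a \<noteq> v k"
  proof (cases "csqrt Q = v k")
    case True
    have "- csqrt Q \<noteq> csqrt Q" using Q by simp
    then have "- csqrt Q \<noteq> v k" unfolding True .
    then show ?thesis using that[of "- csqrt Q"] by simp
  qed (use that[of "csqrt Q"] in simp)
  have a0: "a \<noteq> 0" using a Q by auto
  define w where "w i = v i - (if i = k then a else 0)" for i
  define N where "N = (\<Sum>i\<in>?I. w i ^ 2)"
  have sum_k: "(\<Sum>i\<in>?I. (if i = k then a else 0) * x i) = a * x k" for x :: "nat \<Rightarrow> complex"
  proof -
    have "(\<Sum>i\<in>?I. (if i = k then a else 0) * x i) = (\<Sum>i\<in>?I. if i = k then a * x i else 0)"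
      by (intro sum.cong) auto
    then show ?thesis using k by simp
  qed
  have wv: "(\<Sum>i\<in>?I. w i * v i) = a * (a - v k)"
    using sum_k[of v] a
    by (simp add: w_def left_diff_distrib sum_subtractf Q_def power2_eq_square right_diff_distrib)
  have "N = (\<Sum>i\<in>?I. w i * v i) - (\<Sum>i\<in>?I. (if i = k then a else 0) * w i)"
    unfolding N_def sum_subtractf[symmetric]
    by (intro sum.cong) (simp_all add: w_def power2_eq_square algebra_simps)
  then have "N = a * (a - v k) - a * w k" unfolding wv sum_k .
  moreover have "w k = v k - a" by (simp add: w_def)
  ultimately have N: "N = 2 * (a * (a - v k))" by (simp add: algebra_simps)
  then have N0: "N \<noteq> 0" using a0 a(2) by simp
  define h where "h = (\<Sum>i\<in>?I. scalar (w i) * g i)"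
  define g' where "g' i = (if k \<le> i then g i - scalar (2 / N * w i) * h else g i)" for i
  have hform: "h \<in> ternary_forms d"
    unfolding h_def using g
    by (intro ternary_forms_sum ternary_forms_scalar_mult) (auto simp: echelon_def)
  have hk: "2 / N * Poly_Mapping.lookup h (\<nu> k) = 1"
  proof -
    have "Poly_Mapping.lookup h (\<nu> k) = a * (a - v k)"
      using wv by (simp add: h_def lookup_sum v_def)
    then show ?thesis using N N0 by simp
  qed
  have "g' \<in> echelon d s \<nu> (Suc k)"
    unfolding echelon_def
  proof (intro CollectI conjI allI impI)
    fix i assume "i < s"
    then show "g' i \<in> ternary_forms d"
      using g hform unfolding g'_def echelon_def
      by (auto intro!: ternary_forms_diff ternary_forms_scalar_mult)
  next
    fix j i assume j: "j < Suc k" and i: "j < i \<and> i < s"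
    show "Poly_Mapping.lookup (g' i) (\<nu> j) = 0"
    proof (cases "j = k")
      case True
      then have "Poly_Mapping.lookup (g' i) (\<nu> j)
          = v i - w i * (2 / N * Poly_Mapping.lookup h (\<nu> k))"
        using i by (simp add: g'_def lookup_minus v_def)
      then show ?thesis using i True unfolding hk by (simp add: w_def)
    next
      case False
      then have jk: "j < k" using j by simp
      have z: "Poly_Mapping.lookup (g i') (\<nu> j) = 0" if "j < i'" "i' < s" for i'
        using g jk that by (simp add: echelon_def)
      have "Poly_Mapping.lookup h (\<nu> j) = 0"
        unfolding h_def lookup_sum using jk z by (intro sum.neutral) simp
      then show ?thesis using z i by (simp add: g'_def lookup_minus)
    qed
  qed
  moreover have "(\<Sum>i<s. g' i ^ 2) = (\<Sum>i<s. g i ^ 2)"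
  proof -
    have split: "(\<Sum>i<s. x i) = (\<Sum>i<k. x i) + (\<Sum>i\<in>?I. x i)" for x :: "nat \<Rightarrow> ternary_poly"
      using sum.atLeastLessThan_concat[of 0 k s x] k by (simp add: lessThan_atLeast0)
    let ?c = "scalar (2 / N)"
    have c2: "scalar 2 = (2 :: ternary_poly)" by simp
    have cN: "?c * scalar N = 2" using N0 by (simp add: mult_single)
    have NN: "scalar N = (\<Sum>i\<in>?I. scalar (w i) ^ 2)"
    proof -
      have "scalar (\<Sum>i\<in>J. w i ^ 2) = (\<Sum>i\<in>J. scalar (w i) ^ 2)" for J
        by (induction J rule: infinite_finite_induct)
          (simp_all add: single_add mult_single power2_eq_square)
      then show ?thesis by (simp add: N_def)
    qed
    have "(\<Sum>i\<in>?I. g' i ^ 2)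
        = (\<Sum>i\<in>?I. g i ^ 2 - 2 * ?c * h * (scalar (w i) * g i) + (?c * h) ^ 2 * scalar (w i) ^ 2)"
    proof (intro sum.cong refl)
      fix i assume "i \<in> ?I"
      then have "g' i = g i - ?c * scalar (w i) * h" by (simp add: g'_def mult_single)
      then show "g' i ^ 2 = g i ^ 2 - 2 * ?c * h * (scalar (w i) * g i) + (?c * h) ^ 2 * scalar (w i) ^ 2"
        by (simp only: power2_diff power_mult_distrib) (simp add: mult_ac)
    qed
    also have "\<dots> = (\<Sum>i\<in>?I. g i ^ 2) - 2 * ?c * h * h + (?c * h) ^ 2 * scalar N"
      unfolding NN by (simp add: sum.distrib sum_subtractf sum_distrib_left h_def)
    also have "(?c * h) ^ 2 * scalar N = (?c * scalar N) * ?c * h * h"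
      by (simp only: power2_eq_square mult_ac)
    also have "\<dots> = 2 * ?c * h * h" by (simp only: cN)
    finally have "(\<Sum>i\<in>?I. g' i ^ 2) = (\<Sum>i\<in>?I. g i ^ 2)" by simp
    then show ?thesis unfolding split by (simp add: g'_def)
  qed
  ultimately show ?thesis by blast
qed

text \<open>Almost every tuple can be reflected into the next echelon shape, where \<open>P\<close> vanishes. For the others,
  add \<open>t\<close> to the diagonal coefficient of column \<open>k\<close>: the norm of the tail becomes a monic quadratic polynomial in
  \<open>t\<close>, and its product with the value of \<open>P\<close>, a polynomial in \<open>t\<close>, is zero everywhere. So the value
  of \<open>P\<close> is zero also at \<open>t = 0\<close>.\<close>

lemma vanishing_echelon_step:
  assumes P: "P \<in> polynomial_functions"
    and van: "\<And>g. g \<in> echelon d s \<nu> (Suc k) \<Longrightarrow> P (\<Sum>i<s. g i ^ 2) = 0"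
    and k: "k < s" and deg: "monomial_degree (\<nu> k) = d" and inj: "\<And>j. j < k \<Longrightarrow> \<nu> j \<noteq> \<nu> k"
    and g: "g \<in> echelon d s \<nu> k"
  shows "P (\<Sum>i<s. g i ^ 2) = 0"
proof -
  define e where "e = (Poly_Mapping.single (\<nu> k) 1 :: ternary_poly)"
  define G where "G t = g(k := g k + scalar t * e)" for t
  define b where "b = Poly_Mapping.lookup (g k) (\<nu> k)"
  define r where "r = (\<Sum>i\<in>{Suc k..<s}. Poly_Mapping.lookup (g i) (\<nu> k) ^ 2)"
  have G: "G t \<in> echelon d s \<nu> k" for t
  proof -
    have "Poly_Mapping.lookup e (\<nu> j) = 0" if "j < k" for j
      using inj[OF that] by (simp add: e_def lookup_single)
    moreover have "e \<in> ternary_forms d" unfolding e_def using deg by (rule ternary_forms_single)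
    ultimately show ?thesis
      using g by (auto simp: echelon_def G_def lookup_add
          intro!: ternary_forms_add ternary_forms_scalar_mult)
  qed
  have norm: "(\<Sum>i\<in>{k..<s}. Poly_Mapping.lookup (G t i) (\<nu> k) ^ 2) = poly [:b ^ 2 + r, 2 * b, 1:] t" for t
  proof -
    have "(\<Sum>i\<in>{k..<s}. Poly_Mapping.lookup (G t i) (\<nu> k) ^ 2) = (b + t) ^ 2 + r"
      using k by (simp add: sum.atLeast_Suc_lessThan G_def r_def b_def e_def lookup_add)
    then show ?thesis by (simp add: power2_eq_square algebra_simps)
  qed
  have expand: "(\<Sum>i<s. G t i ^ 2)
      = (\<Sum>i<s. g i ^ 2) + scalar t * (2 * g k * e) + scalar (t ^ 2) * e ^ 2" for t
  proof -
    have rem: "(\<Sum>i<s. x i) = x k + (\<Sum>i\<in>{..<s} - {k}. x i)" for x :: "nat \<Rightarrow> ternary_poly"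
      using k by (intro sum.remove) auto
    have "scalar (t ^ 2) = scalar t * scalar t" by (simp add: mult_single power2_eq_square)
    then show ?thesis
      unfolding rem[of "\<lambda>i. G t i ^ 2"] rem[of "\<lambda>i. g i ^ 2"]
      by (simp add: G_def power2_eq_square algebra_simps)
  qed
  have "\<exists>p. \<forall>t. P (\<Sum>i<s. G t i ^ 2) = poly p t"
    unfolding expand by (rule polynomial_function_along_curve[OF P lookup_quadratic_curve])
  then obtain p where p: "\<And>t. P (\<Sum>i<s. G t i ^ 2) = poly p t" by blast
  have "poly p t = 0 \<or> poly [:b ^ 2 + r, 2 * b, 1:] t = 0" for t
  proof (rule disjCI)
    assume "poly [:b ^ 2 + r, 2 * b, 1:] t \<noteq> 0"
    then obtain g' where "g' \<in> echelon d s \<nu> (Suc k)" "(\<Sum>i<s. g' i ^ 2) = (\<Sum>i<s. G t i ^ 2)"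
      using echelon_reflection[OF G k, of t] unfolding norm by blast
    then show "poly p t = 0" using van[of g'] p[of t] by simp
  qed
  then have "\<forall>t. poly (p * [:b ^ 2 + r, 2 * b, 1:]) t = 0"
    unfolding poly_mult mult_eq_0_iff by blast
  then have "p * [:b ^ 2 + r, 2 * b, 1:] = 0" using poly_all_0_iff_0 by blast
  then have "p = 0" unfolding mult_eq_0_iff by simp
  moreover have "G 0 = g" by (simp add: G_def)
  ultimately show ?thesis using p[of 0] by simp
qed

text \<open>Dimension count: \<open>s\<close> forms have \<open>s * (d + 2 choose 2)\<close> coefficients, and the orthogonal group, of
  dimension \<open>(s choose 2)\<close>, acts on them without changing the sum of squares. The bound
  \<open>s \<le> (d + 2 choose 2)\<close> gives room for a full triangle of zeros in the coefficient matrix.\<close>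

lemma sums_of_squares_not_dense:
  assumes s: "s \<le> (d + 2) choose 2"
    and less: "s * ((d + 2) choose 2) < ((2 * d + 2) choose 2) + (s choose 2)"
  shows "\<not> zariski_dense (2 * d) (sums_of_squares d s)"
proof -
  define N where "N = (d + 2) choose 2"
  define M where "M = (2 * d + 2) choose 2"
  obtain \<nu> where \<nu>: "bij_betw \<nu> {..<N} (monomials d)"
    using ex_bij_betw_nat_finite[OF finite_monomials[of d]]
    by (auto simp: card_monomials N_def lessThan_atLeast0)
  obtain \<mu> where \<mu>: "bij_betw \<mu> {..<M} (monomials (2 * d))"
    using ex_bij_betw_nat_finite[OF finite_monomials[of "2 * d"]]
    by (auto simp: card_monomials M_def lessThan_atLeast0)
  \<comment> \<open>The free entries of a triangular coefficient matrix.\<close>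
  define V where "V = (SIGMA i:{..<s}. {i..<N})"
  have card_V: "card V < M"
  proof -
    have "s \<le> N \<Longrightarrow> (\<Sum>i<s. N - i) + (s choose 2) = s * N"
    proof (induction s)
      case (Suc s)
      have "Suc s choose 2 = s + (s choose 2)"
        using binomial_Suc_Suc[of s 1] unfolding Suc_1 choose_one .
      then show ?case using Suc by (simp add: algebra_simps)
    qed (simp add: numeral_2_eq_2)
    then show ?thesis using s less by (simp add: V_def N_def M_def)
  qed
  have V: "finite V" by (simp add: V_def)
  define \<phi> :: "nat \<Rightarrow> (nat \<times> nat \<Rightarrow>\<^sub>0 nat) \<Rightarrow>\<^sub>0 complex"
    where "\<phi> l = (\<Sum>i<s. \<Sum>j\<in>{i..<N}. \<Sum>j'\<in>{i..<N}.
    if \<nu> j + \<nu> j' = \<mu> l then var (i, j) * var (i, j') else 0)" for l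
  have X: "Poly_Mapping.keys (var v) \<subseteq> box V 1" if "v \<in> V" for v
    using that by (auto simp: var_def box_def lookup_single when_def)
  have keys: "Poly_Mapping.keys (\<phi> l) \<subseteq> box V (1 + 1)" for l
    unfolding \<phi>_def
  proof (intro keys_sum_subset)
    fix i j j' assume "i \<in> {..<s}" "j \<in> {i..<N}" "j' \<in> {i..<N}"
    then have "Poly_Mapping.keys (var (i, j) * var (i, j')) \<subseteq> box V (1 + 1)"
      by (intro keys_mult_box X) (auto simp: V_def)
    then show "Poly_Mapping.keys (if \<nu> j + \<nu> j' = \<mu> l then var (i, j) * var (i, j') else 0)
        \<subseteq> box V (1 + 1)" by simp
  qed
  obtain P where P: "P \<in> polynomial_functions" "\<exists>f\<in>ternary_forms (2 * d). P f \<noteq> 0"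
    and van: "\<forall>f x. (\<forall>j<M. Poly_Mapping.lookup f (\<mu> j) = poly_value x (\<phi> j)) \<longrightarrow> P f = 0"
    using polynomial_function_relation[where \<phi> = \<phi>, OF V card_V keys \<mu>] by blast
  have "P (\<Sum>i<s. g i ^ 2) = 0" if g: "g \<in> echelon d s \<nu> k" and "k \<le> s" for g k
    using \<open>k \<le> s\<close> g
  proof (induction k arbitrary: g rule: inc_induct)
    case base
    define x where "x = (\<lambda>(i, j). Poly_Mapping.lookup (g i) (\<nu> j))"
    show ?case
    proof (rule van[rule_format, of _ x])
      fix l assume "l < M"
      have gi: "g i = (\<Sum>j\<in>{i..<N}. Poly_Mapping.single (\<nu> j) (x (i, j)))" if i: "i < s" for i
      proof -
        have "Poly_Mapping.keys (g i) \<subseteq> monomials d"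
          using base i by (auto simp: echelon_def ternary_forms_def monomials_def)
        then have "g i = (\<Sum>m\<in>monomials d. Poly_Mapping.single m (Poly_Mapping.lookup (g i) m))"
          by (intro poly_expansion) simp_all
        also have "\<dots> = (\<Sum>j<N. Poly_Mapping.single (\<nu> j) (x (i, j)))"
          unfolding x_def prod.case by (rule sum.reindex_bij_betw[OF \<nu>, symmetric])
        also have "\<dots> = (\<Sum>j\<in>{i..<N}. Poly_Mapping.single (\<nu> j) (x (i, j)))"
          using base i by (intro sum.mono_neutral_right) (auto simp: x_def echelon_def)
        finally show ?thesis .
      qed
      have "Poly_Mapping.lookup (\<Sum>i<s. g i ^ 2) (\<mu> l)
          = (\<Sum>i<s. \<Sum>j\<in>{i..<N}. \<Sum>j'\<in>{i..<N}.
              if \<nu> j + \<nu> j' = \<mu> l then x (i, j) * x (i, j') else 0)"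
        unfolding lookup_sum
      proof (intro sum.cong refl)
        fix i assume "i \<in> {..<s}"
        then have "i < s" by simp
        show "Poly_Mapping.lookup (g i ^ 2) (\<mu> l) = (\<Sum>j\<in>{i..<N}. \<Sum>j'\<in>{i..<N}.
              if \<nu> j + \<nu> j' = \<mu> l then x (i, j) * x (i, j') else 0)"
          unfolding gi[OF \<open>i < s\<close>] power2_eq_square sum_product lookup_sum mult_single
          by (intro sum.cong) (simp_all add: lookup_single when_def)
      qed
      also have "\<dots> = poly_value x (\<phi> l)"
        unfolding \<phi>_def poly_value_sum
        by (intro sum.cong) (simp_all add: poly_value_mult)
      finally show "Poly_Mapping.lookup (\<Sum>i<s. g i ^ 2) (\<mu> l) = poly_value x (\<phi> l)" .
    qed
  next
    case (step k)
    have kN: "k < N" using step.hyps s by (simp add: N_def)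
    show ?case
    proof (rule vanishing_echelon_step[OF P(1) step.IH \<open>k < s\<close> _ _ step.prems])
      show "monomial_degree (\<nu> k) = d"
        using bij_betwE[OF \<nu>] kN by (simp add: monomials_def)
      show "\<nu> j \<noteq> \<nu> k" if "j < k" for j
        using bij_betw_imp_inj_on[OF \<nu>] kN that by (auto dest: inj_onD)
    qed
  qed
  from this[of _ 0] have "\<forall>f\<in>sums_of_squares d s. P f = 0"
    by (auto simp: sums_of_squares_def echelon_def)
  then show ?thesis using P unfolding zariski_dense_iff by blast
qed

section \<open>Four forms that generate all forms of twice their degree\<close>

text \<open>The part of degree \<open>2 * d\<close> of the ideal generated by \<open>g 0, \<dots>, g (s - 1)\<close>, if these are forms of
  degree \<open>d\<close>.\<close>

definition ideal_part :: "nat \<Rightarrow> nat \<Rightarrow> (nat \<Rightarrow> ternary_poly) \<Rightarrow> ternary_poly set" where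
  "ideal_part d s g = {\<Sum>i<s. g i * h i | h. \<forall>i<s. h i \<in> ternary_forms d}"

lemma ideal_part_add:
  assumes "f \<in> ideal_part d s g" "f' \<in> ideal_part d s g"
  shows "f + f' \<in> ideal_part d s g"
proof -
  obtain h h' where h: "f = (\<Sum>i<s. g i * h i)" "\<forall>i<s. h i \<in> ternary_forms d"
    and h': "f' = (\<Sum>i<s. g i * h' i)" "\<forall>i<s. h' i \<in> ternary_forms d"
    using assms unfolding ideal_part_def by blast
  have "f + f' = (\<Sum>i<s. g i * (h i + h' i))"
    using h(1) h'(1) by (simp add: distrib_left sum.distrib)
  moreover have "\<forall>i<s. h i + h' i \<in> ternary_forms d" using h(2) h'(2) by (simp add: ternary_forms_add)
  ultimately show ?thesis unfolding ideal_part_def by (intro CollectI exI[of _ "\<lambda>i. h i + h' i"] conjI)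
qed

lemma ideal_part_mult:
  assumes "i < s" "h \<in> ternary_forms d"
  shows "g i * h \<in> ideal_part d s g"
proof -
  have "(\<Sum>j<s. g j * (if j = i then h else 0)) = (\<Sum>j<s. if j = i then g i * h else 0)"
    by (intro sum.cong) auto
  also have "\<dots> = g i * h" using assms by simp
  finally show ?thesis using assms unfolding ideal_part_def
    by (intro CollectI exI[of _ "\<lambda>j. if j = i then h else 0"] conjI) auto
qed

lemma ideal_part_multI:
  "f = g i * h \<Longrightarrow> h \<in> ternary_forms d \<Longrightarrow> i < s \<Longrightarrow> f \<in> ideal_part d s g"
  by (simp add: ideal_part_mult)

lemma ideal_part_0: "0 \<in> ideal_part d s g"
  unfolding ideal_part_def by (intro CollectI exI[of _ "\<lambda>_. 0"] conjI) auto

lemma ideal_part_scalar_mult: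
  assumes "f \<in> ideal_part d s g"
  shows "scalar c * f \<in> ideal_part d s g"
proof -
  obtain h where h: "f = (\<Sum>i<s. g i * h i)" "\<forall>i<s. h i \<in> ternary_forms d"
    using assms unfolding ideal_part_def by blast
  have "scalar c * f = (\<Sum>i<s. g i * (scalar c * h i))"
    using h(1) by (simp add: sum_distrib_left mult.left_commute)
  moreover have "\<forall>i<s. scalar c * h i \<in> ternary_forms d"
    using h(2) by (simp add: ternary_forms_scalar_mult)
  ultimately show ?thesis unfolding ideal_part_def
    by (intro CollectI exI[of _ "\<lambda>i. scalar c * h i"] conjI)
qed

lemma ideal_part_sum:
  "(\<And>i. i \<in> I \<Longrightarrow> f i \<in> ideal_part d s g) \<Longrightarrow> (\<Sum>i\<in>I. f i) \<in> ideal_part d s g"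
  by (induction I rule: infinite_finite_induct) (auto intro: ideal_part_add ideal_part_0)

abbreviation X :: ternary_poly where "X \<equiv> var 0"
abbreviation Y :: ternary_poly where "Y \<equiv> var 1"
abbreviation Z :: ternary_poly where "Z \<equiv> var 2"

lemma var_power: "var v ^ n = Poly_Mapping.single (Poly_Mapping.single v n) 1"
  by (induction n) (simp_all add: var_def mult_single single_add[symmetric])

lemma monomial_eq: "Poly_Mapping.single (xyz p q r) c = scalar c * (X ^ p * Y ^ q * Z ^ r)"
  by (simp add: var_power mult_single xyz_def)

lemma forms_mult: "f \<in> ternary_forms a \<Longrightarrow> g \<in> ternary_forms b \<Longrightarrow> a + b = n \<Longrightarrow> f * g \<in> ternary_forms n"
  using ternary_forms_mult by blast

lemma forms_mult3:
  assumes "f \<in> ternary_forms a" "g \<in> ternary_forms b" "h \<in> ternary_forms c" "a + b + c = n"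
  shows "f * g * h \<in> ternary_forms n"
  using assms ternary_forms_mult by blast

lemma var_power_form: "var v ^ n \<in> ternary_forms n"
  unfolding var_power by (intro ternary_forms_single) simp

lemma var_form: "var v \<in> ternary_forms 1"
  using var_power_form[of v 1] by simp

lemma sum_delta_pair:
  fixes f :: "nat \<Rightarrow> nat \<Rightarrow> 'a::comm_monoid_add"
  assumes "a < d" "b < d"
  shows "(\<Sum>i<d. \<Sum>j<d. if i = a \<and> j = b then f i j else 0) = f a b"
proof -
  have "(\<Sum>j<d. if i = a \<and> j = b then f i j else 0) = (if i = a then f a b else 0)" for i
    using assms by (cases "i = a") simp_all
  then show ?thesis using assms by simp
qed

lemma ternary_forms_induct [consumes 1, case_names monomial zero add]:
  assumes "f \<in> ternary_forms n"
    and "\<And>p q r c. p + q + r = n \<Longrightarrow> P (scalar c * (X ^ p * Y ^ q * Z ^ r))"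
    and zero: "P 0"
    and add: "\<And>f g. P f \<Longrightarrow> P g \<Longrightarrow> P (f + g)"
  shows "P f"
proof -
  have mono: "P (Poly_Mapping.single m c)" if "m \<in> Poly_Mapping.keys f" for m c
  proof -
    obtain p q r where m: "m = xyz p q r" using eq_xyz by blast
    then have "p + q + r = n" using that assms(1) by (auto simp: ternary_forms_def)
    then show ?thesis unfolding m monomial_eq by (rule assms(2))
  qed
  have "P (\<Sum>m\<in>T. Poly_Mapping.single m (Poly_Mapping.lookup f m))"
    if "T \<subseteq> Poly_Mapping.keys f" for T
    using that
    by (induction T rule: infinite_finite_induct) (auto intro!: add zero mono)
  from this[OF order_refl] show ?thesis
    by (simp only: poly_expansion[OF finite_keys order_refl, of f, symmetric])
qed

text \<open>A monomial with all exponents below \<open>d\<close> has degree at most \<open>3 * (d - 1)\<close>, which is less than \<open>2 * d\<close>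
  for these \<open>d\<close>.\<close>

lemma pure_powers_generate:
  assumes d: "d = 1 \<or> d = 2" and f: "f \<in> ternary_forms (2 * d)"
  shows "f \<in> ideal_part d 3 (\<lambda>i. var (of_nat i) ^ d)"
    (is "_ \<in> ideal_part d 3 ?g")
  using f
proof (induction rule: ternary_forms_induct)
  case (monomial p q r c)
  have "p \<ge> d \<or> q \<ge> d \<or> r \<ge> d" using monomial d by auto
  then have "X ^ p * Y ^ q * Z ^ r \<in> ideal_part d 3 ?g"
  proof (elim disjE)
    assume "p \<ge> d"
    then have "X ^ p * Y ^ q * Z ^ r = ?g 0 * (X ^ (p - d) * Y ^ q * Z ^ r)"
      by (simp add: mult.assoc[symmetric] power_add[symmetric] del: One_nat_def)
    moreover have "X ^ (p - d) * Y ^ q * Z ^ r \<in> ternary_forms d"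
      using monomial \<open>p \<ge> d\<close> by (intro forms_mult3[OF var_power_form var_power_form var_power_form]) simp
    ultimately show ?thesis by (rule ideal_part_multI[where g = ?g and i = 0]) simp
  next
    assume "q \<ge> d"
    then have "Y ^ q = Y ^ d * Y ^ (q - d)" by (simp add: power_add[symmetric])
    then have "X ^ p * Y ^ q * Z ^ r = ?g 1 * (X ^ p * Y ^ (q - d) * Z ^ r)"
      by (simp add: mult_ac)
    moreover have "X ^ p * Y ^ (q - d) * Z ^ r \<in> ternary_forms d"
      using monomial \<open>q \<ge> d\<close> by (intro forms_mult3[OF var_power_form var_power_form var_power_form]) simp
    ultimately show ?thesis by (rule ideal_part_multI[where g = ?g and i = 1]) simp
  next
    assume "r \<ge> d"
    then have "Z ^ r = Z ^ d * Z ^ (r - d)" by (simp add: power_add[symmetric])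
    then have "X ^ p * Y ^ q * Z ^ r = ?g 2 * (X ^ p * Y ^ q * Z ^ (r - d))"
      by (simp add: mult_ac)
    moreover have "X ^ p * Y ^ q * Z ^ (r - d) \<in> ternary_forms d"
      using monomial \<open>r \<ge> d\<close> by (intro forms_mult3[OF var_power_form var_power_form var_power_form]) simp
    ultimately show ?thesis by (rule ideal_part_multI[where g = ?g and i = 2]) simp
  qed
  then show ?case by (rule ideal_part_scalar_mult)
qed (auto intro: ideal_part_0 ideal_part_add)

definition column :: "nat set \<Rightarrow> ternary_poly" where
  "column I = (\<Prod>i\<in>I. X - of_nat i * Z)"

definition row :: "nat set \<Rightarrow> ternary_poly" where
  "row J = (\<Prod>j\<in>J. Y - of_nat j * Z)"

definition diagonals :: "nat set \<Rightarrow> ternary_poly" where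
  "diagonals K = (\<Prod>k\<in>K. X + Y - of_nat k * Z)"

lemma of_nat_Z_form: "of_nat k * Z \<in> ternary_forms 1"
  by (rule forms_mult[OF ternary_forms_of_nat var_form]) simp

lemma column_form: "finite I \<Longrightarrow> card I = n \<Longrightarrow> column I \<in> ternary_forms n"
  unfolding column_def
  using ternary_forms_prod_linear[of I "\<lambda>i. X - of_nat i * Z"]
  by (auto intro: ternary_forms_diff var_form of_nat_Z_form simp del: One_nat_def)

lemma row_form: "finite I \<Longrightarrow> card I = n \<Longrightarrow> row I \<in> ternary_forms n"
  unfolding row_def
  using ternary_forms_prod_linear[of I "\<lambda>i. Y - of_nat i * Z"]
  by (auto intro: ternary_forms_diff var_form of_nat_Z_form simp del: One_nat_def)

lemma diagonals_form: "finite I \<Longrightarrow> card I = n \<Longrightarrow> diagonals I \<in> ternary_forms n"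
  unfolding diagonals_def
  using ternary_forms_prod_linear[of I "\<lambda>i. X + Y - of_nat i * Z"]
  by (auto intro: ternary_forms_diff ternary_forms_add var_form of_nat_Z_form simp del: One_nat_def)

definition grid_point :: "nat \<Rightarrow> nat \<Rightarrow> 3 \<Rightarrow> complex" where
  "grid_point i j v = (if v = 0 then of_nat i else if v = 1 then of_nat j else 1)"

abbreviation at_grid :: "nat \<Rightarrow> nat \<Rightarrow> ternary_poly \<Rightarrow> complex" where
  "at_grid i j \<equiv> poly_value (grid_point i j)"

lemma at_vars [simp]: "at_grid i j X = of_nat i" "at_grid i j Y = of_nat j" "at_grid i j Z = 1"
  by (simp_all add: grid_point_def)

lemma at_column: "at_grid i j (column I) = (\<Prod>a\<in>I. of_nat i - of_nat a)"
  unfolding column_def poly_value_simps at_vars by simp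

lemma at_row: "at_grid i j (row J) = (\<Prod>b\<in>J. of_nat j - of_nat b)"
  unfolding row_def poly_value_simps at_vars by simp

lemma at_diagonals: "at_grid i j (diagonals K) = (\<Prod>k\<in>K. of_nat (i + j) - of_nat k)"
  unfolding diagonals_def poly_value_simps at_vars by simp

lemma at_eq_0_iff:
  "finite I \<Longrightarrow> at_grid i j (column I) = 0 \<longleftrightarrow> i \<in> I"
  "finite I \<Longrightarrow> at_grid i j (row I) = 0 \<longleftrightarrow> j \<in> I"
  "finite I \<Longrightarrow> at_grid i j (diagonals I) = 0 \<longleftrightarrow> i + j \<in> I"
  unfolding at_column at_row at_diagonals by (auto simp del: of_nat_add)

text \<open>The Newton basis of interpolation on the grid, homogenized. In contrast to the monomials it
  is triangular at the grid points: for \<open>a, b < d\<close> the value at \<open>(i, j)\<close> is zero if \<open>i < a\<close> or \<open>j < b\<close>, and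
  nonzero at \<open>(a, b)\<close>.\<close>

definition newton :: "nat \<Rightarrow> nat \<Rightarrow> nat \<Rightarrow> ternary_poly" where
  "newton d a b = column {..<a} * row {..<b} * Z ^ (2 * d - a - b)"

definition newton_span :: "nat \<Rightarrow> ternary_poly set" where
  "newton_span d = {u + (\<Sum>a<d. \<Sum>b<d. scalar (c a b) * newton d a b) | u c.
     u \<in> ideal_part d 2 (\<lambda>i. if i = 0 then column {..<d} else row {..<d})}"

lemma newton_span_add:
  assumes "f \<in> newton_span d" "f' \<in> newton_span d"
  shows "f + f' \<in> newton_span d"
proof -
  let ?S = "\<lambda>c. \<Sum>a<d. \<Sum>b<d. scalar (c a b) * newton d a b"
  obtain u c u' c' where
    u: "f = u + ?S c" "u \<in> ideal_part d 2 (\<lambda>i. if i = 0 then column {..<d} else row {..<d})"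
    and u': "f' = u' + ?S c'" "u' \<in> ideal_part d 2 (\<lambda>i. if i = 0 then column {..<d} else row {..<d})"
    using assms unfolding newton_span_def by blast
  have "f + f' = (u + u') + ?S (\<lambda>a b. c a b + c' a b)"
    unfolding u u' by (simp add: single_add distrib_right sum.distrib)
  then show ?thesis
    using ideal_part_add[OF u(2) u'(2)] unfolding newton_span_def
    by (intro CollectI exI[of _ "u + u'"] exI[of _ "\<lambda>a b. c a b + c' a b"] conjI)
qed

lemma newton_span_scalar_mult:
  assumes "f \<in> newton_span d"
  shows "scalar s * f \<in> newton_span d"
proof -
  let ?S = "\<lambda>c. \<Sum>a<d. \<Sum>b<d. scalar (c a b) * newton d a b"
  obtain u c where
    u: "f = u + ?S c" "u \<in> ideal_part d 2 (\<lambda>i. if i = 0 then column {..<d} else row {..<d})"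
    using assms unfolding newton_span_def by blast
  have "scalar s * f = scalar s * u + ?S (\<lambda>a b. s * c a b)"
    unfolding u by (simp add: distrib_left sum_distrib_left mult_single mult.assoc[symmetric])
  then show ?thesis
    using ideal_part_scalar_mult[OF u(2)] unfolding newton_span_def
    by (intro CollectI exI[of _ "scalar s * u"] exI[of _ "\<lambda>a b. s * c a b"] conjI)
qed

lemma newton_span_ideal:
  assumes "u \<in> ideal_part d 2 (\<lambda>i. if i = 0 then column {..<d} else row {..<d})"
  shows "u \<in> newton_span d"
  unfolding newton_span_def using assms
  by (intro CollectI exI[of _ u] exI[of _ "\<lambda>_ _. 0"] conjI) simp_all

lemma column_lessThan_add:
  assumes "d \<le> a"
  shows "column {..<a} = column {..<d} * column {d..<a}"
proof -
  have "{..<a} = {..<d} \<union> {d..<a}" using assms by auto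
  moreover have "{..<d} \<inter> {d..<a} = {}" by auto
  ultimately show ?thesis unfolding column_def by (simp only: prod.union_disjoint finite_lessThan finite_atLeastLessThan)
qed

lemma row_lessThan_add:
  assumes "d \<le> a"
  shows "row {..<a} = row {..<d} * row {d..<a}"
proof -
  have "{..<a} = {..<d} \<union> {d..<a}" using assms by auto
  moreover have "{..<d} \<inter> {d..<a} = {}" by auto
  ultimately show ?thesis unfolding row_def by (simp only: prod.union_disjoint finite_lessThan finite_atLeastLessThan)
qed

lemma X_mult_column: "X * column {..<a} = column {..<Suc a} + of_nat a * (Z * column {..<a})"
  by (simp add: column_def algebra_simps)

lemma Y_mult_row: "Y * row {..<b} = row {..<Suc b} + of_nat b * (Z * row {..<b})"
  by (simp add: row_def algebra_simps)

lemma scalar_of_nat: "scalar (of_nat k) = of_nat k"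
  by simp

text \<open>Monomials (\<open>a = b = 0\<close>) turn into Newton products (\<open>p = q = 0\<close>) by the rule
  \<open>X * column {..<a} = column {..<Suc a} + a * Z * column {..<a}\<close> and its analogue for \<open>Y\<close>. A Newton product with
  \<open>a \<ge> d\<close> or \<open>b \<ge> d\<close> is a multiple of all columns or of all rows, and the other factor has degree \<open>d\<close>.\<close>

lemma mixed_product_in_newton_span:
  "a + b + p + q + r = 2 * d \<Longrightarrow>
    column {..<a} * row {..<b} * X ^ p * Y ^ q * Z ^ r \<in> newton_span d"
proof (induction "p + q" arbitrary: a b p q r)
  case 0
  let ?g = "\<lambda>i::nat. if i = 0 then column {..<d} else row {..<d}"
  have pq: "p = 0" "q = 0" using 0 by auto
  show ?case
  proof (cases "a < d \<and> b < d")
    case True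
    let ?c = "\<lambda>a' b'. if a' = a \<and> b' = b then 1 else (0::complex)"
    have "(\<Sum>a'<d. \<Sum>b'<d. scalar (?c a' b') * newton d a' b')
        = (\<Sum>a'<d. \<Sum>b'<d. if a' = a \<and> b' = b then newton d a' b' else 0)"
      by (intro sum.cong refl) simp
    also have "\<dots> = newton d a b" using True by (intro sum_delta_pair) auto
    also have "\<dots> = column {..<a} * row {..<b} * X ^ p * Y ^ q * Z ^ r"
    proof -
      have "2 * d - a - b = r" using 0 pq by simp
      then show ?thesis unfolding newton_def pq by simp
    qed
    finally have "column {..<a} * row {..<b} * X ^ p * Y ^ q * Z ^ r
        = 0 + (\<Sum>a'<d. \<Sum>b'<d. scalar (?c a' b') * newton d a' b')" by simp
    then show ?thesis unfolding newton_span_def using ideal_part_0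
      by (intro CollectI exI[of _ 0] exI[of _ ?c] conjI)
  next
    case False
    then consider "d \<le> a" | "d \<le> b" by linarith
    then have "column {..<a} * row {..<b} * Z ^ r \<in> ideal_part d 2 ?g"
    proof cases
      case 1
      have "column {..<a} * row {..<b} * Z ^ r = ?g 0 * (column {d..<a} * row {..<b} * Z ^ r)"
        unfolding column_lessThan_add[OF 1] by (simp add: mult_ac)
      moreover have "column {d..<a} * row {..<b} * Z ^ r \<in> ternary_forms d"
        using 0 1 pq by (intro forms_mult3[OF column_form row_form var_power_form]) auto
      ultimately show ?thesis by (rule ideal_part_multI[where g = ?g and i = 0]) simp
    next
      case 2
      have "column {..<a} * row {..<b} * Z ^ r = ?g 1 * (column {..<a} * row {d..<b} * Z ^ r)"
        unfolding row_lessThan_add[OF 2] by (simp add: mult_ac)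
      moreover have "column {..<a} * row {d..<b} * Z ^ r \<in> ternary_forms d"
        using 0 2 pq by (intro forms_mult3[OF column_form row_form var_power_form]) auto
      ultimately show ?thesis by (rule ideal_part_multI[where g = ?g and i = 1]) simp
    qed
    then show ?thesis unfolding pq by (auto intro: newton_span_ideal)
  qed
next
  case (Suc n)
  show ?case
  proof (cases p)
    case (Suc p')
    let ?R = "row {..<b} * X ^ p' * Y ^ q"
    have "column {..<a} * row {..<b} * X ^ p * Y ^ q * Z ^ r = (X * column {..<a}) * ?R * Z ^ r"
      unfolding Suc by (simp add: mult_ac)
    also have "\<dots> = column {..<Suc a} * row {..<b} * X ^ p' * Y ^ q * Z ^ r
        + scalar (of_nat a) * (column {..<a} * row {..<b} * X ^ p' * Y ^ q * Z ^ Suc r)"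
      unfolding X_mult_column scalar_of_nat by (simp add: algebra_simps)
    finally show ?thesis
      using Suc.hyps(1)[of p' q "Suc a" b r] Suc.hyps(1)[of p' q a b "Suc r"] Suc.hyps(2) Suc.prems Suc
      by (simp only:) (intro newton_span_add newton_span_scalar_mult; simp)
  next
    case 0
    then obtain q' where q: "q = Suc q'" using Suc.hyps(2) by (cases q) auto
    let ?R = "column {..<a} * X ^ p * Y ^ q'"
    have "column {..<a} * row {..<b} * X ^ p * Y ^ q * Z ^ r = (Y * row {..<b}) * ?R * Z ^ r"
      unfolding q by (simp add: mult_ac)
    also have "\<dots> = column {..<a} * row {..<Suc b} * X ^ p * Y ^ q' * Z ^ r
        + scalar (of_nat b) * (column {..<a} * row {..<b} * X ^ p * Y ^ q' * Z ^ Suc r)"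
      unfolding Y_mult_row scalar_of_nat by (simp add: algebra_simps)
    finally show ?thesis
      using Suc.hyps(1)[of p q' a "Suc b" r] Suc.hyps(1)[of p q' a b "Suc r"] Suc.hyps(2) Suc.prems q
      by (simp only:) (intro newton_span_add newton_span_scalar_mult; simp)
  qed
qed

lemma ternary_forms_subset_newton_span:
  assumes "f \<in> ternary_forms (2 * d)"
  shows "f \<in> newton_span d"
  using assms
proof (induction rule: ternary_forms_induct)
  case (monomial p q r c)
  then have "X ^ p * Y ^ q * Z ^ r \<in> newton_span d"
    using mixed_product_in_newton_span[of 0 0 p q r d] by (simp add: column_def row_def)
  then show ?case by (rule newton_span_scalar_mult)
next
  case zero
  show ?case by (intro newton_span_ideal ideal_part_0)
qed (rule newton_span_add)

text \<open>Modulo the ideal, \<open>f\<close> is a combination of Newton products with \<open>a, b < d\<close>. The ideal vanishes on the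
  grid and the Newton products are triangular there, so the coefficients vanish in order of \<open>a + b\<close>.\<close>

lemma vanishing_on_grid:
  assumes f: "f \<in> ternary_forms (2 * d)"
    and van: "\<And>i j. i < d \<Longrightarrow> j < d \<Longrightarrow> at_grid i j f = 0"
  shows "f \<in> ideal_part d 2 (\<lambda>i. if i = 0 then column {..<d} else row {..<d})"
proof -
  let ?g = "\<lambda>i::nat. if i = 0 then column {..<d} else row {..<d}"
  obtain u c where u: "u \<in> ideal_part d 2 ?g"
    and fu: "f = u + (\<Sum>a<d. \<Sum>b<d. scalar (c a b) * newton d a b)"
    using ternary_forms_subset_newton_span[OF f] unfolding newton_span_def by blast
  have u0: "at_grid i j u = 0" if "i < d" "j < d" for i j
  proof -
    obtain h where h: "u = (\<Sum>i<2. ?g i * h i)" using u unfolding ideal_part_def by blast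
    have "at_grid i j (?g k) = 0" for k using that by (simp add: at_eq_0_iff)
    then show ?thesis unfolding h poly_value_sum poly_value_mult by (simp only: mult_zero_left sum.neutral_const)
  qed
  have val: "at_grid i j (newton d a b) = at_grid i j (column {..<a}) * at_grid i j (row {..<b})" for i j a b
    unfolding newton_def poly_value_simps at_vars by simp
  have "\<forall>a b. a + b = n \<longrightarrow> a < d \<longrightarrow> b < d \<longrightarrow> c a b = 0" for n
  proof (induction n rule: less_induct)
    case (less n)
    show ?case
    proof (intro allI impI)
      fix a b assume ab: "a + b = n" "a < d" "b < d"
      have term_0: "c a' b' * at_grid a b (newton d a' b') = 0"
        if "a' < d" "b' < d" "(a', b') \<noteq> (a, b)" for a' b'
      proof (cases "a < a' \<or> b < b'")
        case True
        then show ?thesis unfolding val by (auto simp: at_eq_0_iff)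
      next
        case False
        then have "a' + b' < n" using that(3) ab(1) by auto
        then have "c a' b' = 0" using less.IH that by blast
        then show ?thesis by simp
      qed
      have "0 = at_grid a b f - at_grid a b u" using van u0 ab by simp
      also have "\<dots> = (\<Sum>a'<d. \<Sum>b'<d. c a' b' * at_grid a b (newton d a' b'))"
        unfolding fu by (simp add: poly_value_simps)
      also have "\<dots> = (\<Sum>a'<d. \<Sum>b'<d.
          if a' = a \<and> b' = b then c a' b' * at_grid a b (newton d a' b') else 0)"
        using term_0 by (intro sum.cong refl) simp
      also have "\<dots> = c a b * at_grid a b (newton d a b)" using ab by (intro sum_delta_pair)
      finally have "c a b = 0 \<or> at_grid a b (newton d a b) = 0" by auto
      moreover have "at_grid a b (newton d a b) \<noteq> 0" unfolding val by (simp add: at_eq_0_iff)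
      ultimately show "c a b = 0" by simp
    qed
  qed
  then have "c a b = 0" if "a < d" "b < d" for a b using that by blast
  then have "(\<Sum>a<d. \<Sum>b<d. scalar (c a b) * newton d a b) = 0"
    by (intro sum.neutral ballI) simp
  then show ?thesis using fu u by simp
qed

text \<open>The last two forms split the grid: \<open>diagonals {..<d}\<close> vanishes exactly at the points with \<open>i + j < d\<close>, and
  \<open>diagonals {d..<2 * d - 1}\<close> exactly at the others, as \<open>i + j \<le> 2 * d - 2\<close> on the grid. The factor \<open>Z\<close>, which is 1 at the
  grid points, raises the degree from \<open>d - 1\<close> to \<open>d\<close>.\<close>

definition grid_forms :: "nat \<Rightarrow> nat \<Rightarrow> ternary_poly" where
  "grid_forms d i = (if i = 0 then column {..<d} else if i = 1 then row {..<d}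
     else if i = 2 then diagonals {..<d} else diagonals {d..<2 * d - 1} * Z)"

text \<open>In each of the two triangles, every point other than \<open>(i, j)\<close> lies on one of a few lines that miss
  \<open>(i, j)\<close>. For \<open>i + j < d\<close> these are the columns to the left, the rows below and the antidiagonals
  between \<open>(i, j)\<close> and the other triangle: a point with \<open>i' \<ge> i\<close> and \<open>j' \<ge> j\<close> has \<open>i' + j' > i + j\<close> unless it
  is \<open>(i, j)\<close>. These are \<open>d - 1\<close> lines; in the other triangle the mirror
  image uses \<open>d - 2\<close> lines. A power of \<open>Z\<close> completes the degree.\<close>

lemma lagrange_element:
  assumes i: "i < d" and j: "j < d"
  shows "\<exists>e\<in>ideal_part d 4 (grid_forms d). e \<in> ternary_forms (2 * d) \<and>
    (\<forall>i'<d. \<forall>j'<d. at_grid i' j' e = (if i' = i \<and> j' = j then 1 else 0))"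
proof -
  have "\<exists>e\<in>ideal_part d 4 (grid_forms d). e \<in> ternary_forms (2 * d) \<and>
    (\<forall>i'<d. \<forall>j'<d. at_grid i' j' e = 0 \<longleftrightarrow> \<not> (i' = i \<and> j' = j))"
  proof (cases "i + j < d")
    case True
    define h where "h = column {..<i} * row {..<j} * diagonals {Suc (i + j)..<d} * Z ^ 1"
    have h: "h \<in> ternary_forms d"
      unfolding h_def using True
      by (intro forms_mult[OF forms_mult3[OF column_form row_form diagonals_form] var_power_form]) auto
    have g: "grid_forms d 3 = diagonals {d..<2 * d - 1} * Z ^ 1" by (simp add: grid_forms_def)
    have gf: "grid_forms d 3 \<in> ternary_forms d"
      unfolding g using i by (intro forms_mult[OF diagonals_form var_power_form]) auto
    have "at_grid i' j' (grid_forms d 3 * h) = 0 \<longleftrightarrow> \<not> (i' = i \<and> j' = j)" if "i' < d" "j' < d" for i' j'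
      unfolding g h_def poly_value_simps at_vars using that True
      by (simp add: at_eq_0_iff) linarith
    moreover have "grid_forms d 3 * h \<in> ternary_forms (2 * d)" using gf h by (rule forms_mult) simp
    ultimately show ?thesis using ideal_part_mult[of 3 4 h d "grid_forms d"] h by auto
  next
    case False
    define h where "h = column {Suc i..<d} * row {Suc j..<d} * diagonals {d..<i + j} * Z ^ 2"
    have h: "h \<in> ternary_forms d"
      unfolding h_def using False i j
      by (intro forms_mult[OF forms_mult3[OF column_form row_form diagonals_form] var_power_form]) auto
    have g: "grid_forms d 2 = diagonals {..<d}" by (simp add: grid_forms_def)
    have gf: "grid_forms d 2 \<in> ternary_forms d"
      unfolding g by (intro diagonals_form) auto
    have "at_grid i' j' (grid_forms d 2 * h) = 0 \<longleftrightarrow> \<not> (i' = i \<and> j' = j)" if "i' < d" "j' < d" for i' j'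
      unfolding g h_def poly_value_simps at_vars using that False
      by (simp add: at_eq_0_iff) linarith
    moreover have "grid_forms d 2 * h \<in> ternary_forms (2 * d)" using gf h by (rule forms_mult) simp
    ultimately show ?thesis using ideal_part_mult[of 2 4 h d "grid_forms d"] h by auto
  qed
  then obtain e where e: "e \<in> ideal_part d 4 (grid_forms d)" "e \<in> ternary_forms (2 * d)"
    "\<And>i' j'. i' < d \<Longrightarrow> j' < d \<Longrightarrow> at_grid i' j' e = 0 \<longleftrightarrow> \<not> (i' = i \<and> j' = j)" by blast
  let ?s = "scalar (1 / at_grid i j e)"
  have "at_grid i' j' (?s * e) = (if i' = i \<and> j' = j then 1 else 0)" if "i' < d" "j' < d" for i' j'
    using e(3)[OF that] e(3)[OF i j] by (auto simp: poly_value_mult)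
  then show ?thesis
    using ideal_part_scalar_mult[OF e(1)] ternary_forms_scalar_mult[OF e(2)] by blast
qed

text \<open>Subtracting the Lagrange interpolation of \<open>f\<close> leaves a form that vanishes on the grid.\<close>

lemma grid_forms_generate:
  assumes f: "f \<in> ternary_forms (2 * d)"
  shows "f \<in> ideal_part d 4 (grid_forms d)"
proof -
  have "\<forall>i\<in>{..<d}. \<forall>j\<in>{..<d}. \<exists>e. e \<in> ideal_part d 4 (grid_forms d) \<and> e \<in> ternary_forms (2 * d) \<and>
    (\<forall>i'<d. \<forall>j'<d. at_grid i' j' e = (if i' = i \<and> j' = j then 1 else 0))"
    using lagrange_element by blast
  then obtain e where e: "\<forall>i\<in>{..<d}. \<forall>j\<in>{..<d}. e i j \<in> ideal_part d 4 (grid_forms d) \<and>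
      e i j \<in> ternary_forms (2 * d) \<and>
      (\<forall>i'<d. \<forall>j'<d. at_grid i' j' (e i j) = (if i' = i \<and> j' = j then 1 else 0))"
    unfolding bchoice_iff by blast
  define r where "r = (\<Sum>i<d. \<Sum>j<d. scalar (at_grid i j f) * e i j)"
  have r: "r \<in> ternary_forms (2 * d)" "r \<in> ideal_part d 4 (grid_forms d)"
    unfolding r_def using e
    by (auto intro!: ternary_forms_sum ternary_forms_scalar_mult ideal_part_sum ideal_part_scalar_mult)
  have "at_grid i' j' r = at_grid i' j' f" if "i' < d" "j' < d" for i' j'
  proof -
    have "at_grid i' j' r = (\<Sum>i<d. \<Sum>j<d. if i = i' \<and> j = j' then at_grid i j f else 0)"
      unfolding r_def poly_value_sum using e that
      by (intro sum.cong refl) (auto simp: poly_value_mult)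
    also have "\<dots> = at_grid i' j' f" using that by (intro sum_delta_pair)
    finally show ?thesis .
  qed
  then have "f - r \<in> ideal_part d 2 (\<lambda>i. if i = 0 then column {..<d} else row {..<d})"
    using f r by (intro vanishing_on_grid) (simp_all add: ternary_forms_diff poly_value_diff)
  then obtain h :: "nat \<Rightarrow> ternary_poly" where h: "\<forall>i<2. h i \<in> ternary_forms d"
    "f - r = (\<Sum>i<2. (if i = 0 then column {..<d} else row {..<d}) * h i)"
    unfolding ideal_part_def by blast
  then have "f - r = grid_forms d 0 * h 0 + grid_forms d 1 * h 1"
    by (simp add: grid_forms_def numeral_2_eq_2)
  moreover have "\<dots> \<in> ideal_part d 4 (grid_forms d)"
    using h(1) by (intro ideal_part_add ideal_part_mult) auto
  ultimately have "(f - r) + r \<in> ideal_part d 4 (grid_forms d)"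
    using r(2) by (intro ideal_part_add) simp_all
  then show ?thesis by simp
qed

lemma grid_forms_form:
  assumes "d \<ge> 1"
  shows "grid_forms d i \<in> ternary_forms d"
proof -
  have "diagonals {d..<2 * d - 1} * Z \<in> ternary_forms d"
    using assms by (intro forms_mult[OF diagonals_form[where n = "d - 1"] var_form]) auto
  moreover have "column {..<d} \<in> ternary_forms d" "row {..<d} \<in> ternary_forms d"
    "diagonals {..<d} \<in> ternary_forms d"
    by (intro column_form row_form diagonals_form; simp)+
  ultimately show ?thesis unfolding grid_forms_def by (simp del: One_nat_def)
qed

section \<open>The generic rank\<close>

lemma four_squares_dense:
  assumes "d \<ge> 1"
  shows "zariski_dense (2 * d) (sums_of_squares d 4)"
proof (rule sums_of_squares_dense)
  show "grid_forms d i \<in> ternary_forms d" for i using grid_forms_form[OF assms] .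
  fix f assume "f \<in> ternary_forms (2 * d)"
  then show "\<exists>h. (\<forall>i<4. h i \<in> ternary_forms d) \<and> f = (\<Sum>i<4. grid_forms d i * h i)"
    using grid_forms_generate unfolding ideal_part_def by blast
qed

lemma three_squares_dense:
  assumes "d = 1 \<or> d = 2"
  shows "zariski_dense (2 * d) (sums_of_squares d 3)"
proof (rule sums_of_squares_dense)
  let ?g = "\<lambda>i. var (of_nat i) ^ d"
  show "?g i \<in> ternary_forms d" for i by (rule var_power_form)
  fix f assume "f \<in> ternary_forms (2 * d)"
  then show "\<exists>h. (\<forall>i<3. h i \<in> ternary_forms d) \<and> f = (\<Sum>i<3. ?g i * h i)"
    using pure_powers_generate[OF assms] unfolding ideal_part_def by blast
qed

lemma choose_2_real: "real ((n + 2) choose 2) = real (n + 2) * real (n + 1) / 2"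
proof -
  have "2 * ((n + 2) choose 2) = (n + 2) * (n + 1)"
    by (simp add: choose_two)
  then have "2 * real ((n + 2) choose 2) = real (n + 2) * real (n + 1)"
    by (metis of_nat_mult of_nat_numeral)
  then show ?thesis by simp
qed

lemma generic_two_rank_small:
  assumes "d = 1 \<or> d = 2"
  shows "generic_two_rank d = 3"
proof -
  have "generic_two_rank d = Suc 2"
  proof (rule generic_two_rank_eqI)
    show "zariski_dense (2 * d) (sums_of_squares d (Suc 2))"
      using three_squares_dense[OF assms] by (simp add: numeral_3_eq_3 numeral_2_eq_2)
    show "\<not> zariski_dense (2 * d) (sums_of_squares d 2)"
      using assms by (intro sums_of_squares_not_dense) (auto simp: choose_two)
  qed
  then show ?thesis by simp
qed

text \<open>With \<open>(3 choose 2) = 3\<close> this is the inequality under which sums of three squares are not dense. For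
  \<open>d = 3\<close> and \<open>d = 4\<close> the correction by 3 decides, which is why these degrees are exceptional.\<close>

lemma three_squares_count:
  assumes "d \<ge> 3"
  shows "3 * ((d + 2) choose 2) < ((2 * d + 2) choose 2) + 3"
proof -
  obtain e where d: "d = e + 3" using assms by (metis add.commute le_Suc_ex)
  have "3 * real ((d + 2) choose 2) < real ((2 * d + 2) choose 2) + 3"
    unfolding choose_2_real d by (simp add: field_simps add_pos_nonneg)
  then show ?thesis by linarith
qed

lemma four_squares_count: "((2 * d + 2) choose 2) + 3 * (d + 1) = 4 * ((d + 2) choose 2)"
proof -
  have "real ((2 * d + 2) choose 2) + 3 * (real d + 1) = 4 * real ((d + 2) choose 2)"
    unfolding choose_2_real by (simp add: field_simps)
  then have "real (((2 * d + 2) choose 2) + 3 * (d + 1)) = real (4 * ((d + 2) choose 2))" by simp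
  then show ?thesis unfolding of_nat_eq_iff .
qed

lemma generic_two_rank_large:
  assumes "d \<ge> 3"
  shows "generic_two_rank d = 4"
proof -
  have "generic_two_rank d = Suc 3"
  proof (rule generic_two_rank_eqI)
    show "zariski_dense (2 * d) (sums_of_squares d (Suc 3))"
      using four_squares_dense[of d] assms by simp
    show "\<not> zariski_dense (2 * d) (sums_of_squares d 3)"
    proof (rule sums_of_squares_not_dense)
      show "3 \<le> (d + 2) choose 2"
        using binomial_right_mono[of 3 "d + 2" 2] assms by (simp add: choose_two)
      show "3 * ((d + 2) choose 2) < ((2 * d + 2) choose 2) + (3 choose 2)"
        using three_squares_count[OF assms] by (simp add: choose_two)
    qed
  qed
  then show ?thesis by simp
qed

lemma generic_two_rank_eq_least:
  assumes "d \<ge> 2"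
  shows "generic_two_rank d = (LEAST s::nat. s \<ge> 1 \<and>
    int s * int ((d + 2) choose 2) - int (s choose 2) \<ge> int ((2 * d + 2) choose 2))"
    (is "_ = Least ?P")
proof (cases "d = 2")
  case True
  have "Least ?P = 3"
  proof (rule Least_equality)
    show "?P 3" unfolding True by (simp add: choose_two)
    fix s assume s: "?P s"
    show "3 \<le> s"
    proof (rule ccontr)
      assume "\<not> 3 \<le> s"
      then have "s = 0 \<or> s = 1 \<or> s = 2" by auto
      then show False using s unfolding True by (auto simp: choose_two)
    qed
  qed
  then show ?thesis using generic_two_rank_small[of d] True by simp
next
  case False
  then have d: "d \<ge> 3" using assms by simp
  have three: "3 * int ((d + 2) choose 2) < int ((2 * d + 2) choose 2) + 3"
    using three_squares_count[OF d] by linarith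
  have four: "int ((2 * d + 2) choose 2) + 3 * (int d + 1) = 4 * int ((d + 2) choose 2)"
    using arg_cong[OF four_squares_count[of d], of int]
    unfolding of_nat_add of_nat_mult of_nat_numeral of_nat_1 .
  have "Least ?P = 4"
  proof (rule Least_equality)
    show "?P 4" using four d by (simp add: choose_two)
    fix s assume s: "?P s"
    show "4 \<le> s"
    proof (rule ccontr)
      assume "\<not> 4 \<le> s"
      then consider "s = 0" | "s = 1" | "s = 2" | "s = 3" by linarith
      then show False
        using s three four d by cases (simp_all add: choose_two)
    qed
  qed
  then show ?thesis using generic_two_rank_large[OF d] by simp
qed

lemma ratio_eq: "real ((2 * d + 2) choose 2) / real ((d + 2) choose 2) = 4 - 6 / real (d + 2)"
proof -
  have "real ((2 * d + 2) choose 2) / real ((d + 2) choose 2)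
      = ((real d + 1) * (2 * real d + 1)) / ((real d + 1) * ((real d + 2) / 2))"
    unfolding choose_2_real by (intro arg_cong2[where f = "(/)"]) (simp_all add: field_simps)
  also have "\<dots> = (2 * real d + 1) / ((real d + 2) / 2)"
    by (rule mult_divide_mult_cancel_left) simp
  also have "\<dots> = 4 - 6 / real (d + 2)" by (simp add: field_simps)
  finally show ?thesis .
qed

lemma ceiling_ratio:
  assumes "d \<ge> 1"
  shows "\<lceil>real ((2 * d + 2) choose 2) / real ((d + 2) choose 2)\<rceil>
    = (if d = 1 then 2 else if d \<le> 4 then 3 else 4)"
proof -
  consider "d = 1" | "2 \<le> d" "d \<le> 4" | "5 \<le> d" using assms by linarith
  then show ?thesis unfolding ratio_eq
  proof cases
    case 2
    then have "2 < 4 - 6 / real (d + 2)" "4 - 6 / real (d + 2) \<le> 3" by (simp_all add: field_simps)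
    then show "\<lceil>4 - 6 / real (d + 2)\<rceil> = (if d = 1 then 2 else if d \<le> 4 then 3 else 4)"
      using 2 by (simp add: ceiling_eq_iff)
  next
    case 3
    then have "3 < 4 - 6 / real (d + 2)" "4 - 6 / real (d + 2) \<le> 4" by (simp_all add: field_simps)
    then show "\<lceil>4 - 6 / real (d + 2)\<rceil> = (if d = 1 then 2 else if d \<le> 4 then 3 else 4)"
      using 3 by (simp add: ceiling_eq_iff)
  qed simp
qed

theorem corollaryA5:
  shows "(\<forall>d::nat. d \<ge> 2 \<longrightarrow>
      generic_two_rank d =
        (LEAST s::nat. s \<ge> 1 \<and>
          int s * int ((d + 2) choose 2) - int (s choose 2) \<ge> int ((2 * d + 2) choose 2)))
    \<and> (\<forall>d::nat. d \<ge> 1 \<longrightarrow>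
      (d \<notin> {1, 3, 4} \<longrightarrow>
        int (generic_two_rank d) =
          \<lceil>real ((2 * d + 2) choose 2) / real ((d + 2) choose 2)\<rceil>) \<and>
      (d \<in> {1, 3, 4} \<longrightarrow>
        int (generic_two_rank d) =
          \<lceil>real ((2 * d + 2) choose 2) / real ((d + 2) choose 2)\<rceil> + 1))"
proof (intro conjI allI impI)
  fix d :: nat
  assume "d \<ge> 2"
  then show "generic_two_rank d = (LEAST s::nat. s \<ge> 1 \<and>
      int s * int ((d + 2) choose 2) - int (s choose 2) \<ge> int ((2 * d + 2) choose 2))"
    by (rule generic_two_rank_eq_least)
next
  fix d :: nat
  assume d: "d \<ge> 1" "d \<notin> {1, 3, 4}"
  then have "d = 2 \<or> d \<ge> 5" unfolding insert_iff empty_iff by presburger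
  then show "int (generic_two_rank d) = \<lceil>real ((2 * d + 2) choose 2) / real ((d + 2) choose 2)\<rceil>"
    unfolding ceiling_ratio[OF d(1)] by (elim disjE) (simp_all add: generic_two_rank_small generic_two_rank_large)
next
  fix d :: nat
  assume d: "d \<ge> 1" "d \<in> {1, 3, 4}"
  then show "int (generic_two_rank d) = \<lceil>real ((2 * d + 2) choose 2) / real ((d + 2) choose 2)\<rceil> + 1"
    unfolding ceiling_ratio[OF d(1)] by (auto simp: generic_two_rank_small generic_two_rank_large)
qed

end
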